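(* Let $A$ be a $C^*$-algebra, $X$ a Hilbert $C^*$-module over $A$, $\mathcal{H},\mathcal{K}$ Hilbert spaces, $\varphi:A\to L(\mathcal{H})$ a completely positive linear map and $\Phi:X\to L(\mathcal{H},\mathcal{K})$ a $\varphi$-map. Then: (1) $X_\Phi$ is a Hilbert $C^*$-module over $M_\varphi$ (with the module action and inner product inherited from $X$); (2) $\Phi|_{X_\Phi}:X_\Phi\to L(\mathcal{H},\mathcal{K})$ is a $\varphi|_{M_\varphi}$-representation; (3) $\Phi|_{X_\Phi}:X_\Phi\to L(\mathcal{H},\mathcal{K})$ is a ternary map.
   Context: Hilbert $C^*$-modules are right modules, with inner product linear in the second variable and conjugate linear in the first. $L(\mathcal{H},\mathcal{K})$ denotes the bounded linear operators from $\mathcal{H}$ to $\mathcal{K}$, and $L(\mathcal{H})=L(\mathcal{H},\mathcal{H})$. A map $\Phi:X\to L(\mathcal{H},\mathcal{K})$ is a $\varphi$-map if $\Phi(x)^*\Phi(y)=\varphi(\langle x,y\rangle)$ for all $x,y\in X$; if $\varphi$ is a $*$-homomorphism, a $\varphi$-map is called a $\varphi$-representation. The multiplicative domain of $\varphi$ is the $C^*$-subalgebra $M_\varphi=\{a\in A:\varphi(ab)=\varphi(a)\varphi(b)\text{ and }\varphi(ba)=\varphi(b)\varphi(a)\text{ for all }b\in A\}$ of $A$. The $\varphi$-module domain of $\Phi$ is $X_\Phi=\{x\in X:\Phi(xb)=\Phi(x)\varphi(b)\text{ for all }b\in A\}$. A map $\Psi:Y\to L(\mathcal{H},\mathcal{K})$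 on a Hilbert $C^*$-module $Y$ is a ternary map if $\Psi(x\langle y,z\rangle)=\Psi(x)\Psi(y)^*\Psi(z)$ for all $x,y,z\in Y$. *)

theory Defs
  imports "HOL-Analysis.Analysis"
begin

section \<open>Complex vector spaces and normed spaces\<close>

class complex_vector = real_vector +
  fixes scaleC :: "complex \<Rightarrow> 'a \<Rightarrow> 'a"  (infixr "*\<^sub>C" 75)
  assumes scaleC_add_right: "c *\<^sub>C (x + y) = c *\<^sub>C x + c *\<^sub>C y"
    and scaleC_add_left: "(c + d) *\<^sub>C x = c *\<^sub>C x + d *\<^sub>C x"
    and scaleC_scaleC: "c *\<^sub>C (d *\<^sub>C x) = (c * d) *\<^sub>C x"
    and scaleC_of_real: "complex_of_real r *\<^sub>C x = r *\<^sub>R x"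

class complex_normed_vector = complex_vector + real_normed_vector +
  assumes norm_scaleC: "norm (c *\<^sub>C x) = cmod c * norm x"

definition csubspace :: "'a::complex_vector set \<Rightarrow> bool" where
  "csubspace S \<longleftrightarrow> 0 \<in> S \<and> (\<forall>x\<in>S. \<forall>y\<in>S. x + y \<in> S) \<and> (\<forall>c. \<forall>x\<in>S. c *\<^sub>C x \<in> S)"

definition clinear_on :: "'a::complex_vector set \<Rightarrow> ('a \<Rightarrow> 'b::complex_vector) \<Rightarrow> bool" where
  "clinear_on S f \<longleftrightarrow>
     (\<forall>x\<in>S. \<forall>y\<in>S. f (x + y) = f x + f y) \<and> (\<forall>c. \<forall>x\<in>S. f (c *\<^sub>C x) = c *\<^sub>C f x)"

instantiation complex :: complex_normed_vector
begin
definition scaleC_complex_def: "(c::complex) *\<^sub>C (x::complex) = c * x"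
instance
  by standard (simp_all add: scaleC_complex_def algebra_simps scaleR_conv_of_real norm_mult)
end

lemma scaleC_scaleR_commute:
  "c *\<^sub>C (r *\<^sub>R x) = r *\<^sub>R (c *\<^sub>C (x::'c::complex_vector))"
proof -
  have "c *\<^sub>C (r *\<^sub>R x) = (c * complex_of_real r) *\<^sub>C x"
    by (simp add: scaleC_scaleC flip: scaleC_of_real)
  then show ?thesis
    by (simp add: scaleC_scaleC mult.commute flip: scaleC_of_real)
qed

instantiation blinfun :: (real_normed_vector, complex_normed_vector) complex_vector
begin
definition scaleC_blinfun_def: "c *\<^sub>C f = Blinfun (\<lambda>x. c *\<^sub>C blinfun_apply f x)"

lemma blinfun_apply_scaleC:
  "blinfun_apply (c *\<^sub>C f) x = c *\<^sub>C blinfun_apply (f :: 'a \<Rightarrow>\<^sub>L 'b) x"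
proof -
  have "bounded_linear (\<lambda>x. c *\<^sub>C blinfun_apply f x)"
  proof (rule bounded_linear_intro[where K = "cmod c * norm f"])
    show "norm (c *\<^sub>C blinfun_apply f x) \<le> norm x * (cmod c * norm f)" for x
      using mult_left_mono[OF norm_blinfun[of f x], of "cmod c"]
      by (simp add: norm_scaleC mult_ac)
  qed (simp_all add: blinfun.add_right blinfun.scaleR_right scaleC_add_right scaleC_scaleR_commute)
  then show ?thesis
    by (simp add: scaleC_blinfun_def bounded_linear_Blinfun_apply)
qed

instance
  by standard
    (rule blinfun_eqI; simp add: blinfun_apply_scaleC blinfun.add_left blinfun.scaleR_left
      scaleC_add_right scaleC_add_left scaleC_scaleC scaleC_of_real)+
end


section \<open>\<open>C\<^sup>*\<close>-algebras\<close>

class cstar_algebra = complex_normed_vector + real_normed_algebra + banach +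
  fixes star :: "'a \<Rightarrow> 'a"
  assumes scaleC_mult_left: "(c *\<^sub>C x) * y = c *\<^sub>C (x * y)"
    and scaleC_mult_right: "x * (c *\<^sub>C y) = c *\<^sub>C (x * y)"
    and star_add: "star (x + y) = star x + star y"
    and star_scaleC: "star (c *\<^sub>C x) = cnj c *\<^sub>C star x"
    and star_mult: "star (x * y) = star y * star x"
    and star_star: "star (star x) = x"
    and cstar_identity: "norm (star x * x) = (norm x)\<^sup>2"

instantiation complex :: cstar_algebra
begin
definition star_complex_def: "star (x::complex) = cnj x"
instance
  by standard
    (simp_all add: scaleC_complex_def star_complex_def norm_mult power2_eq_square)
end

text \<open>A \<open>C\<^sup>*\<close>-subalgebra is in particular a (complete) \<open>C\<^sup>*\<close>-algebra in its own right.  It need not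
  contain a unit, even if the ambient algebra has one.\<close>

definition cstar_subalgebra :: "'a::cstar_algebra set \<Rightarrow> bool" where
  "cstar_subalgebra B \<longleftrightarrow> csubspace B \<and> closed B \<and>
     (\<forall>a\<in>B. \<forall>b\<in>B. a * b \<in> B) \<and> (\<forall>a\<in>B. star a \<in> B)"


section \<open>Hilbert spaces and bounded operators\<close>

class chilbert_space = complex_normed_vector + banach +
  fixes cinner :: "'a \<Rightarrow> 'a \<Rightarrow> complex"
  assumes cinner_commute: "cinner x y = cnj (cinner y x)"
    and cinner_add_right: "cinner x (y + z) = cinner x y + cinner x z"
    and cinner_scaleC_right: "cinner x (c *\<^sub>C y) = c * cinner x y"
    and cinner_ge_zero: "0 \<le> Re (cinner x x)"
    and norm_eq_sqrt_cinner: "norm x = sqrt (Re (cinner x x))"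

instantiation complex :: chilbert_space
begin
definition cinner_complex_def: "cinner (x::complex) y = cnj x * y"
instance
  by standard
    (simp_all add: scaleC_complex_def cinner_complex_def algebra_simps cmod_def power2_eq_square)
end

text \<open>\<^typ>\<open>'h \<Rightarrow>\<^sub>L 'k\<close> consists of the bounded real-linear maps; \<open>L(H, K)\<close> is the following subset.\<close>

definition cblin :: "('h::complex_normed_vector \<Rightarrow>\<^sub>L 'k::complex_normed_vector) set" where
  "cblin = {T. \<forall>c x. blinfun_apply T (c *\<^sub>C x) = c *\<^sub>C blinfun_apply T x}"

definition is_adjoint ::
    "('h::chilbert_space \<Rightarrow>\<^sub>L 'k::chilbert_space) \<Rightarrow> ('k \<Rightarrow>\<^sub>L 'h) \<Rightarrow> bool" where
  "is_adjoint T S \<longleftrightarrow> S \<in> cblin \<and>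
     (\<forall>x y. cinner (blinfun_apply T x) y = cinner x (blinfun_apply S y))"

definition adj :: "('h::chilbert_space \<Rightarrow>\<^sub>L 'k::chilbert_space) \<Rightarrow> ('k \<Rightarrow>\<^sub>L 'h)" where
  "adj T = (THE S. is_adjoint T S)"

text \<open>By the Riesz representation theorem, the adjoint exists and is unique.\<close>

lemma scaleC_zero_left [simp]: "0 *\<^sub>C x = 0"
  using scaleC_of_real[of 0 x] by simp

lemma scaleC_minus_left: "(- c) *\<^sub>C x = - (c *\<^sub>C x)"
  using scaleC_add_left[of c "- c" x] by (simp add: eq_neg_iff_add_eq_0 add.commute)

lemma cinner_add_left: "cinner (x + y) z = cinner x z + cinner y z"
  by (metis cinner_add_right cinner_commute complex_cnj_add)

lemma cinner_scaleC_left: "cinner (c *\<^sub>C x) y = cnj c * cinner x y"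
  by (metis cinner_commute cinner_scaleC_right complex_cnj_mult)

lemma cinner_scaleR_right: "cinner x (r *\<^sub>R y) = complex_of_real r * cinner x y"
  by (metis cinner_scaleC_right scaleC_of_real)

lemma cinner_scaleR_left: "cinner (r *\<^sub>R x) y = complex_of_real r * cinner x y"
  by (metis cinner_scaleC_left scaleC_of_real complex_cnj_complex_of_real)

lemma cinner_minus_right: "cinner x (- y) = - cinner x y"
  using cinner_scaleR_right[of x "- 1" y] by simp

lemma cinner_minus_left: "cinner (- x) y = - cinner x y"
  using cinner_scaleR_left[of "- 1" x y] by simp

lemma cinner_diff_right: "cinner x (y - z) = cinner x y - cinner x z"
  using cinner_add_right[of x y "- z"] by (simp add: cinner_minus_right)

lemma cinner_diff_left: "cinner (x - y) z = cinner x z - cinner y z"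
  using cinner_add_left[of x "- y" z] by (simp add: cinner_minus_left)

lemma Re_cinner_self: "Re (cinner x x) = (norm x)\<^sup>2"
  by (simp add: norm_eq_sqrt_cinner cinner_ge_zero)

lemma cinner_self: "cinner x x = complex_of_real ((norm x)\<^sup>2)"
proof -
  have "Im (cinner x x) = - Im (cinner x x)"
    by (metis cinner_commute cnj.simps(2))
  then show ?thesis
    by (simp add: complex_eq_iff Re_cinner_self flip: of_real_power)
qed

lemma norm_add_square:
  "(norm (x + y))\<^sup>2 = (norm x)\<^sup>2 + (norm y)\<^sup>2 + 2 * Re (cinner x (y::'a::chilbert_space))"
proof -
  have "Re (cinner y x) = Re (cinner x y)"
    by (metis cinner_commute cnj.simps(1))
  then show ?thesis
    by (simp add: cinner_add_left cinner_add_right flip: Re_cinner_self)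
qed

lemma parallelogram_law:
  "(norm (x + y))\<^sup>2 + (norm (x - y))\<^sup>2 = 2 * (norm x)\<^sup>2 + 2 * (norm (y::'a::chilbert_space))\<^sup>2"
  using norm_add_square[of x y] norm_add_square[of x "- y"] by (simp add: cinner_minus_right)

lemma cinner_right_unique:
  assumes "\<And>x. cinner x y = cinner x z"
  shows "y = z"
proof -
  have "cinner (y - z) (y - z) = 0"
    using assms[of "y - z"] by (simp add: cinner_diff_right)
  then show ?thesis
    by (simp add: cinner_self)
qed

lemma cauchy_schwarz: "cmod (cinner x y) \<le> norm x * norm (y::'a::chilbert_space)"
proof (cases "norm y = 0")
  case True
  then have "y = 0" by simp
  then show ?thesis using cinner_scaleR_right[of x 0 y] by simp
next
  case False
  define c where "c = cinner y x"
  define t where "t = 1 / (norm y)\<^sup>2"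
  have c: "Re (cinner x (c *\<^sub>C y)) = (cmod c)\<^sup>2"
    by (metis c_def cinner_commute cinner_scaleC_right complex_norm_square Re_complex_of_real)
  have "0 \<le> (norm (x + (- t) *\<^sub>R (c *\<^sub>C y)))\<^sup>2" by simp
  also have "\<dots> = (norm x)\<^sup>2 + t\<^sup>2 * ((cmod c)\<^sup>2 * (norm y)\<^sup>2) - 2 * t * (cmod c)\<^sup>2"
    unfolding norm_add_square cinner_scaleR_right
    by (simp add: norm_scaleC power_mult_distrib c)
  also have "t\<^sup>2 * ((cmod c)\<^sup>2 * (norm y)\<^sup>2) = t * (cmod c)\<^sup>2"
    using False by (simp add: t_def field_simps power2_eq_square)
  finally have "t * (cmod c)\<^sup>2 \<le> (norm x)\<^sup>2" by simp
  then have "(cmod c)\<^sup>2 \<le> (norm x * norm y)\<^sup>2"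
    using False by (simp add: t_def field_simps power_mult_distrib)
  then have "cmod c \<le> norm x * norm y"
    by (rule power2_le_imp_le) simp
  moreover have "cmod (cinner x y) = cmod c"
    by (metis c_def cinner_commute complex_mod_cnj)
  ultimately show ?thesis by simp
qed

lemma riesz_representation:
  fixes f :: "'a::chilbert_space \<Rightarrow> complex"
  assumes bl: "bounded_linear f" and hom: "\<And>c x. f (c *\<^sub>C x) = c * f x"
  shows "\<exists>z. \<forall>x. f x = cinner z x"
proof (cases "\<forall>x. f x = 0")
  case True
  have "cinner 0 x = 0" for x :: 'a
    using cinner_scaleR_left[of 0 x x] by simp
  with True have "\<forall>x. f x = cinner 0 x" by simp
  then show ?thesis by blast
next
  case False
  interpret f: bounded_linear f by (rule bl)
  from False obtain w where "f w \<noteq> 0" by blast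
  define S where "S = {x. f x = 1}"
  have "(1 / f w) *\<^sub>C w \<in> S"
    using \<open>f w \<noteq> 0\<close> by (simp add: S_def hom)
  then have ne: "norm ` S \<noteq> {}" by blast
  define d where "d = Inf (norm ` S)"
  have bdd: "bdd_below (norm ` S)" by (rule bdd_belowI[of _ 0]) auto
  have d_le: "d \<le> norm x" if "x \<in> S" for x
    unfolding d_def using that bdd by (intro cInf_lower) auto
  have d0: "0 \<le> d"
    unfolding d_def using ne by (intro cInf_greatest) auto
  have "\<exists>x\<in>S. norm x < d + 1 / (real n + 1)" for n
  proof -
    have "Inf (norm ` S) < d + 1 / (real n + 1)"
      by (simp add: d_def add_pos_nonneg)
    then show ?thesis
      using cInf_lessD[OF ne] by blast
  qed
  then obtain s where sS: "\<And>n. s n \<in> S" and s: "\<And>n. norm (s n) < d + 1 / (real n + 1)"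
    by metis
  have est: "(norm (s m - s n))\<^sup>2 \<le> (8 * d + 4) / (real N + 1)" if "N \<le> m" "N \<le> n" for m n N
  proof -
    define h where "h = 1 / (real N + 1)"
    have h: "0 \<le> h" "h \<le> 1" by (auto simp: h_def)
    have le: "(norm (s k))\<^sup>2 \<le> d\<^sup>2 + (2 * d + 1) * h" if "N \<le> k" for k
    proof -
      have "1 / (real k + 1) \<le> h"
        unfolding h_def using that by (intro divide_left_mono) auto
      then have "norm (s k) \<le> d + h" using s[of k] by linarith
      then have "(norm (s k))\<^sup>2 \<le> (d + h)\<^sup>2" by (intro power_mono) auto
      also have "\<dots> = d\<^sup>2 + 2 * d * h + h * h" by (simp add: power2_eq_square algebra_simps)
      also have "\<dots> \<le> d\<^sup>2 + (2 * d + 1) * h"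
        using mult_right_mono[OF h(2) h(1)] by (simp add: algebra_simps)
      finally show ?thesis .
    qed
    have "(1 / 2) *\<^sub>R (s m + s n) \<in> S"
      using sS[of m] sS[of n] by (simp add: S_def f.add f.scaleR scaleR_conv_of_real)
    then have "d \<le> norm (s m + s n) / 2"
      using d_le by fastforce
    then have "(2 * d)\<^sup>2 \<le> (norm (s m + s n))\<^sup>2"
      using d0 by (intro power_mono) auto
    then have "(norm (s m - s n))\<^sup>2 \<le> 2 * (norm (s m))\<^sup>2 + 2 * (norm (s n))\<^sup>2 - 4 * d\<^sup>2"
      using parallelogram_law[of "s m" "s n"] by (simp add: power_mult_distrib)
    also have "\<dots> \<le> 4 * ((2 * d + 1) * h)"
      using le[OF that(1)] le[OF that(2)] by linarith
    also have "\<dots> = (8 * d + 4) / (real N + 1)"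
      by (simp add: h_def)
    finally show ?thesis .
  qed
  have "Cauchy s"
  proof (rule metric_CauchyI)
    fix e :: real assume e: "0 < e"
    obtain N :: nat where N: "(8 * d + 4) / e\<^sup>2 < real N"
      using reals_Archimedean2 by blast
    have "(8 * d + 4) < e\<^sup>2 * real N"
      using N e by (simp add: field_simps)
    also have "\<dots> \<le> e\<^sup>2 * (real N + 1)"
      by (intro mult_left_mono) auto
    finally have b: "(8 * d + 4) / (real N + 1) < e\<^sup>2"
      by (simp add: divide_less_eq)
    have "dist (s m) (s n) < e" if "N \<le> m" "N \<le> n" for m n
    proof -
      have "(norm (s m - s n))\<^sup>2 < e\<^sup>2" using est[OF that] b by linarith
      then show ?thesis
        using e by (simp add: dist_norm power_less_imp_less_base)
    qed
    then show "\<exists>M. \<forall>m\<ge>M. \<forall>n\<ge>M. dist (s m) (s n) < e" by blast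
  qed
  then obtain u where u: "s \<longlonglongrightarrow> u"
    using Cauchy_convergent_iff convergent_def by blast
  have "(\<lambda>n. f (s n)) \<longlonglongrightarrow> f u" using u by (rule f.tendsto)
  moreover have "(\<lambda>n. f (s n)) \<longlonglongrightarrow> 1" using sS by (simp add: S_def)
  ultimately have fu: "f u = 1" using LIMSEQ_unique by blast
  have "norm u \<le> d"
  proof (rule LIMSEQ_le)
    show "(\<lambda>n. norm (s n)) \<longlonglongrightarrow> norm u" using u by (rule tendsto_norm)
    show "(\<lambda>n. d + 1 / (real n + 1)) \<longlonglongrightarrow> d"
      using tendsto_add[OF tendsto_const[of d] LIMSEQ_inverse_real_of_nat]
      by (simp add: inverse_eq_divide add.commute)
    show "\<exists>N. \<forall>n\<ge>N. norm (s n) \<le> d + 1 / (real n + 1)" using s less_imp_le by blast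
  qed
  have u_min: "norm u \<le> norm (u + v)" if "f v = 0" for v
  proof -
    have "u + v \<in> S" using that fu by (simp add: S_def f.add)
    then show ?thesis using d_le \<open>norm u \<le> d\<close> by fastforce
  qed
  have orth: "cinner u v = 0" if v: "f v = 0" for v
  proof (rule ccontr)
    assume nz: "cinner u v \<noteq> 0"
    define c where "c = cinner v u"
    have c: "cinner u (c *\<^sub>C v) = complex_of_real ((cmod c)\<^sup>2)"
      by (metis c_def cinner_commute cinner_scaleC_right complex_norm_square)
    have c0: "cmod c > 0"
      using nz cinner_commute[of u v] by (auto simp: c_def)
    define t where "t = 1 / (1 + (norm v)\<^sup>2)"
    have t0: "t > 0" by (simp add: t_def add_pos_nonneg)
    have t1: "t * (norm v)\<^sup>2 \<le> 1" by (simp add: t_def divide_le_eq add_pos_nonneg)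
    have "f ((- t) *\<^sub>R (c *\<^sub>C v)) = 0"
      by (simp only: f.scaleR hom v mult_zero_right scaleR_zero_right)
    from u_min[OF this] have "(norm u)\<^sup>2 \<le> (norm (u + (- t) *\<^sub>R (c *\<^sub>C v)))\<^sup>2"
      by (intro power_mono) auto
    also have "\<dots> = (norm u)\<^sup>2 + t * (t * (norm v)\<^sup>2 * (cmod c)\<^sup>2) - 2 * t * (cmod c)\<^sup>2"
      unfolding norm_add_square cinner_scaleR_right c
      by (simp add: norm_scaleC power_mult_distrib power2_eq_square)
    also have "t * (t * (norm v)\<^sup>2 * (cmod c)\<^sup>2) \<le> t * (1 * (cmod c)\<^sup>2)"
      using t1 t0 by (intro mult_left_mono mult_right_mono) auto
    finally have "t * (cmod c)\<^sup>2 \<le> 0" by simp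
    moreover have "t * (cmod c)\<^sup>2 > 0" using t0 c0 by simp
    ultimately show False by linarith
  qed
  have u0: "norm u \<noteq> 0" using fu f.zero by auto
  have main: "f x = cinner ((1 / (norm u)\<^sup>2) *\<^sub>R u) x" for x
  proof -
    have "f (x - f x *\<^sub>C u) = 0" by (simp add: f.diff hom fu)
    then have "cinner u (x - f x *\<^sub>C u) = 0" by (rule orth)
    then have "cinner u x = f x * complex_of_real ((norm u)\<^sup>2)"
      by (simp add: cinner_diff_right cinner_scaleC_right cinner_self)
    then show ?thesis
      using u0 by (simp add: cinner_scaleR_left)
  qed
  show ?thesis
  proof
    show "\<forall>x. f x = cinner ((1 / (norm u)\<^sup>2) *\<^sub>R u) x" using main by blast
  qed
qed

lemma is_adjoint_unique: "is_adjoint T S \<Longrightarrow> is_adjoint T S' \<Longrightarrow> S = S'"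
  unfolding is_adjoint_def by (metis blinfun_eqI cinner_right_unique)

lemma ex_is_adjoint:
  fixes T :: "'h::chilbert_space \<Rightarrow>\<^sub>L 'k::chilbert_space"
  assumes T: "T \<in> cblin"
  shows "\<exists>S. is_adjoint T S"
proof -
  have "\<exists>z. \<forall>x. cinner y (blinfun_apply T x) = cinner z x" for y
  proof (rule riesz_representation)
    show "bounded_linear (\<lambda>x. cinner y (blinfun_apply T x))"
    proof (rule bounded_linear_intro[where K = "norm y * norm T"])
      fix x
      have "cmod (cinner y (blinfun_apply T x)) \<le> norm y * norm (blinfun_apply T x)"
        by (rule cauchy_schwarz)
      also have "\<dots> \<le> norm y * (norm T * norm x)"
        by (intro mult_left_mono norm_blinfun) auto
      finally show "cmod (cinner y (blinfun_apply T x)) \<le> norm x * (norm y * norm T)"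
        by (simp add: mult_ac)
    qed (simp_all add: blinfun.add_right blinfun.scaleR_right cinner_add_right
        cinner_scaleR_right scaleR_conv_of_real)
    show "cinner y (blinfun_apply T (c *\<^sub>C x)) = c * cinner y (blinfun_apply T x)" for c x
      using T by (simp add: cblin_def cinner_scaleC_right)
  qed
  then obtain g where g: "\<And>y x. cinner y (blinfun_apply T x) = cinner (g y) x"
    by metis
  have g': "cinner (blinfun_apply T x) y = cinner x (g y)" for x y
    by (metis g cinner_commute)
  have bl: "bounded_linear g"
  proof (rule bounded_linear_intro[where K = "norm T"])
    show "g (x + y) = g x + g y" for x y
      by (rule cinner_right_unique) (simp add: cinner_add_right flip: g')
    show "g (r *\<^sub>R x) = r *\<^sub>R g x" for r x
      by (rule cinner_right_unique) (simp add: cinner_scaleR_right flip: g')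
    show "norm (g y) \<le> norm y * norm T" for y
    proof (cases "g y = 0")
      case False
      have "(norm (g y))\<^sup>2 = cmod (cinner (g y) (g y))"
        by (simp add: cinner_self norm_power)
      also have "\<dots> = cmod (cinner (blinfun_apply T (g y)) y)" by (simp add: g')
      also have "\<dots> \<le> norm (blinfun_apply T (g y)) * norm y" by (rule cauchy_schwarz)
      also have "\<dots> \<le> (norm T * norm (g y)) * norm y"
        by (intro mult_right_mono norm_blinfun) auto
      finally show ?thesis
        using False by (simp add: power2_eq_square mult_ac)
    qed simp
  qed
  have "g (c *\<^sub>C x) = c *\<^sub>C g x" for c x
    by (rule cinner_right_unique) (simp add: cinner_scaleC_right flip: g')
  then have "is_adjoint T (Blinfun g)"
    by (simp add: is_adjoint_def cblin_def bounded_linear_Blinfun_apply[OF bl] g')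
  then show ?thesis by blast
qed

lemma is_adjoint_adj: "T \<in> cblin \<Longrightarrow> is_adjoint T (adj T)"
  unfolding adj_def by (metis (mono_tags) ex_is_adjoint is_adjoint_unique theI)


section \<open>Completely positive maps\<close>

text \<open>Positivity of an \<open>n \<times> n\<close> matrix \<open>a\<close> over a \<open>*\<close>-algebra with carrier \<open>B\<close>, product \<open>mul\<close> and
  involution \<open>st\<close>: it has the form \<open>b\<^sup>* b\<close> with \<open>b\<close> in \<open>M\<^sub>n(B)\<close>.  Only entries with indices
  below \<open>n\<close> matter.  The operations are parameters so that the same notion applies to a
  \<open>C\<^sup>*\<close>-algebra given as a type and to \<open>L(H)\<close>.\<close>

definition positive_matrix ::
    "'b::ab_group_add set \<Rightarrow> ('b \<Rightarrow> 'b \<Rightarrow> 'b) \<Rightarrow> ('b \<Rightarrow> 'b) \<Rightarrow> nat \<Rightarrow> (nat \<Rightarrow> nat \<Rightarrow> 'b) \<Rightarrow> bool" where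
  "positive_matrix B mul st n a \<longleftrightarrow>
     (\<exists>b. (\<forall>i<n. \<forall>j<n. b i j \<in> B) \<and>
          (\<forall>i<n. \<forall>j<n. a i j = (\<Sum>k<n. mul (st (b k i)) (b k j))))"

definition completely_positive ::
    "('a::cstar_algebra \<Rightarrow> ('h::chilbert_space \<Rightarrow>\<^sub>L 'h)) \<Rightarrow> bool" where
  "completely_positive \<phi> \<longleftrightarrow>
     (\<forall>n a. positive_matrix UNIV (*) star n a \<longrightarrow>
        positive_matrix cblin (o\<^sub>L) adj n (\<lambda>i j. \<phi> (a i j)))"

definition star_homomorphism_on ::
    "'a::cstar_algebra set \<Rightarrow> ('a \<Rightarrow> ('h::chilbert_space \<Rightarrow>\<^sub>L 'h)) \<Rightarrow> bool" where
  "star_homomorphism_on B \<phi> \<longleftrightarrow> \<phi> ` B \<subseteq> cblin \<and> clinear_on B \<phi> \<and>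
     (\<forall>a\<in>B. \<forall>b\<in>B. \<phi> (a * b) = \<phi> a o\<^sub>L \<phi> b) \<and> (\<forall>a\<in>B. \<phi> (star a) = adj (\<phi> a))"


section \<open>Hilbert \<open>C\<^sup>*\<close>-modules\<close>

text \<open>Right Hilbert module \<open>E\<close> over the \<open>C\<^sup>*\<close>-algebra \<open>B\<close>, with action \<open>act\<close> and inner product
  \<open>ip\<close>.  Both \<open>B\<close> and \<open>E\<close> are subsets of ambient types, so that submodules over subalgebras are
  covered; positivity of \<open>ip x x\<close> is positivity in \<open>B\<close>.  Completeness refers to the norm
  \<open>sqrt \<parallel>ip x x\<parallel>\<close>.\<close>

locale hilbert_cstar_module =
  fixes B :: "'a::cstar_algebra set"
    and E :: "'x::complex_vector set"
    and act :: "'x \<Rightarrow> 'a \<Rightarrow> 'x"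
    and ip :: "'x \<Rightarrow> 'x \<Rightarrow> 'a"
  assumes algebra: "cstar_subalgebra B"
    and module: "csubspace E"
    and act_closed: "x \<in> E \<Longrightarrow> a \<in> B \<Longrightarrow> act x a \<in> E"
    and act_add_left: "x \<in> E \<Longrightarrow> y \<in> E \<Longrightarrow> a \<in> B \<Longrightarrow> act (x + y) a = act x a + act y a"
    and act_add_right: "x \<in> E \<Longrightarrow> a \<in> B \<Longrightarrow> b \<in> B \<Longrightarrow> act x (a + b) = act x a + act x b"
    and act_mult: "x \<in> E \<Longrightarrow> a \<in> B \<Longrightarrow> b \<in> B \<Longrightarrow> act x (a * b) = act (act x a) b"
    and act_scaleC_left: "x \<in> E \<Longrightarrow> a \<in> B \<Longrightarrow> act (c *\<^sub>C x) a = c *\<^sub>C act x a"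
    and act_scaleC_right: "x \<in> E \<Longrightarrow> a \<in> B \<Longrightarrow> act x (c *\<^sub>C a) = c *\<^sub>C act x a"
    and ip_closed: "x \<in> E \<Longrightarrow> y \<in> E \<Longrightarrow> ip x y \<in> B"
    and ip_add_right: "x \<in> E \<Longrightarrow> y \<in> E \<Longrightarrow> z \<in> E \<Longrightarrow> ip x (y + z) = ip x y + ip x z"
    and ip_scaleC_right: "x \<in> E \<Longrightarrow> y \<in> E \<Longrightarrow> ip x (c *\<^sub>C y) = c *\<^sub>C ip x y"
    and ip_act_right: "x \<in> E \<Longrightarrow> y \<in> E \<Longrightarrow> a \<in> B \<Longrightarrow> ip x (act y a) = ip x y * a"
    and ip_star: "x \<in> E \<Longrightarrow> y \<in> E \<Longrightarrow> star (ip x y) = ip y x"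
    and ip_pos: "x \<in> E \<Longrightarrow> \<exists>b\<in>B. ip x x = star b * b"
    and ip_definite: "x \<in> E \<Longrightarrow> ip x x = 0 \<Longrightarrow> x = 0"
    and complete:
      "(\<And>n. s n \<in> E) \<Longrightarrow>
       (\<forall>e>0. \<exists>N. \<forall>m\<ge>N. \<forall>n\<ge>N. sqrt (norm (ip (s m - s n) (s m - s n))) < e) \<Longrightarrow>
       \<exists>x\<in>E. (\<lambda>n. sqrt (norm (ip (s n - x) (s n - x)))) \<longlonglongrightarrow> 0"


section \<open>Module maps and domains\<close>

definition phi_map ::
    "'x set \<Rightarrow> ('x \<Rightarrow> 'x \<Rightarrow> 'a) \<Rightarrow> ('a \<Rightarrow> ('h::chilbert_space \<Rightarrow>\<^sub>L 'h)) \<Rightarrow>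
     ('x \<Rightarrow> ('h \<Rightarrow>\<^sub>L 'k::chilbert_space)) \<Rightarrow> bool" where
  "phi_map E ip \<phi> \<Phi> \<longleftrightarrow> \<Phi> ` E \<subseteq> cblin \<and> (\<forall>x\<in>E. \<forall>y\<in>E. adj (\<Phi> x) o\<^sub>L \<Phi> y = \<phi> (ip x y))"

definition phi_representation ::
    "'a::cstar_algebra set \<Rightarrow> 'x set \<Rightarrow> ('x \<Rightarrow> 'x \<Rightarrow> 'a) \<Rightarrow>
     ('a \<Rightarrow> ('h::chilbert_space \<Rightarrow>\<^sub>L 'h)) \<Rightarrow> ('x \<Rightarrow> ('h \<Rightarrow>\<^sub>L 'k::chilbert_space)) \<Rightarrow> bool" where
  "phi_representation B E ip \<phi> \<Phi> \<longleftrightarrow> star_homomorphism_on B \<phi> \<and> phi_map E ip \<phi> \<Phi>"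

definition ternary_map ::
    "'x set \<Rightarrow> ('x \<Rightarrow> 'a \<Rightarrow> 'x) \<Rightarrow> ('x \<Rightarrow> 'x \<Rightarrow> 'a) \<Rightarrow>
     ('x \<Rightarrow> ('h::chilbert_space \<Rightarrow>\<^sub>L 'k::chilbert_space)) \<Rightarrow> bool" where
  "ternary_map E act ip \<Psi> \<longleftrightarrow> \<Psi> ` E \<subseteq> cblin \<and>
     (\<forall>x\<in>E. \<forall>y\<in>E. \<forall>z\<in>E. \<Psi> (act x (ip y z)) = \<Psi> x o\<^sub>L adj (\<Psi> y) o\<^sub>L \<Psi> z)"

definition multiplicative_domain ::
    "('a::cstar_algebra \<Rightarrow> ('h::chilbert_space \<Rightarrow>\<^sub>L 'h)) \<Rightarrow> 'a set" where
  "multiplicative_domain \<phi> = {a. \<forall>b. \<phi> (a * b) = \<phi> a o\<^sub>L \<phi> b \<and> \<phi> (b * a) = \<phi> b o\<^sub>L \<phi> a}"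

definition module_domain ::
    "('x \<Rightarrow> 'a \<Rightarrow> 'x) \<Rightarrow> ('a \<Rightarrow> ('h::chilbert_space \<Rightarrow>\<^sub>L 'h)) \<Rightarrow>
     ('x \<Rightarrow> ('h \<Rightarrow>\<^sub>L 'k::chilbert_space)) \<Rightarrow> 'x set" where
  "module_domain act \<phi> \<Phi> = {x. \<forall>b. \<Phi> (act x b) = \<Phi> x o\<^sub>L \<phi> b}"

end

theory Submission
  imports Defs
begin

text \<open>
  The algebraic part of the theorem is a short computation.  A \<open>\<phi>\<close>-map is automatically linear, since
  \<open>\<langle>\<Phi>(x)h, \<Phi>(y)h\<rangle> = \<langle>h, \<phi>(\<langle>x, y\<rangle>)h\<rangle>\<close> shows that \<open>\<Phi>(x + y)h - \<Phi>(x)h - \<Phi>(y)h\<close> has norm zero, and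
  likewise for scalars.  For \<open>x, y\<close> in the module domain, \<open>\<phi>(\<langle>x, y\<rangle>b) = \<Phi>(x)\<^sup>*\<Phi>(yb) = \<phi>(\<langle>x, y\<rangle>)\<phi>(b)\<close>;
  multiplication by \<open>b\<close> on the left is moved into the first argument of the inner product, where it
  becomes the action of \<open>b\<^sup>*\<close>.  So the inner product takes values in the multiplicative domain, and
  the identity \<open>\<Phi>(x\<langle>y, z\<rangle>) = \<Phi>(x)\<phi>(\<langle>y, z\<rangle>) = \<Phi>(x)\<Phi>(y)\<^sup>*\<Phi>(z)\<close> is immediate.

  Three points need analysis.  That \<open>\<phi>\<close> preserves adjoints makes the multiplicative domain closed
  under the involution.  That \<open>\<phi>\<close> is bounded makes the multiplicative domain closed and the module
  domain complete.  Finally, \<open>\<langle>x, x\<rangle>\<close> must have the form \<open>b\<^sup>*b\<close> with \<open>b\<close> in the multiplicative domain,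
  and not merely in the whole algebra.  All three rest on square roots of positive elements.
  For the third, the root of an element stays in every closed \<open>*\<close>-subalgebra containing the element
  (\<open>pos_elem_sqrt\<close>).  For the other two, a self-adjoint element splits into a difference of positive ones
  with norm control (\<open>selfadjoint_decomposition\<close>).  Hence \<open>\<phi>\<close> maps self-adjoint elements to self-adjoint
  operators (\<open>adj_star\<close>), and it is bounded by a gliding hump argument (\<open>bounded_on_pos_elem\<close>): values
  of norm more than \<open>4\<^sup>n\<close> at positive contractions \<open>p\<^sub>n\<close> would be dominated by \<open>2\<^sup>n\<phi>(a)\<close> for one single
  element \<open>a\<close>.

  Square roots are obtained without spectral theory.  The algebra is embedded into a unital
  \<open>C\<^sup>*\<close>-algebra, where a self-adjoint \<open>h\<close> is called positive when \<open>\<parallel>t - h\<parallel> \<le> t\<close> for some \<open>t \<ge> 0\<close>.  With this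
  description positive elements visibly form a cone, and the iteration \<open>s \<mapsto> (u + s\<^sup>2)/2\<close> converges to
  \<open>1 - \<surd>(1 - u)\<close> for \<open>\<parallel>u\<parallel> \<le> 1\<close>, so every positive element is a square (\<open>cpos_sqrt\<close>).  Conversely, if \<open>x\<close> is
  self-adjoint with \<open>\<parallel>x\<parallel> \<le> 1\<close>, then \<open>x + i\<surd>(1 - x\<^sup>2)\<close> is unitary, and this gives the positivity of
  squares (\<open>cpos_square\<close>).  The positivity of \<open>b\<^sup>*b\<close> (\<open>cpos_star_mult\<close>) then follows as in Kaplansky's
  argument.
\<close>

section \<open>Complex scalars and the involution\<close>

lemma scaleC_zero_right [simp]: "c *\<^sub>C (0::'a::complex_vector) = 0"
  using scaleC_add_right[of c 0 "0::'a"] by simp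

lemma scaleC_one [simp]: "1 *\<^sub>C (x::'a::complex_vector) = x"
  using scaleC_of_real[of 1 x] by simp

lemma scaleC_minus_right: "c *\<^sub>C (- x) = - (c *\<^sub>C (x::'a::complex_vector))"
  using scaleC_scaleR_commute[of c "-1" x] by simp

lemma scaleC_diff_right: "c *\<^sub>C (x - y) = c *\<^sub>C x - c *\<^sub>C (y::'a::complex_vector)"
  using scaleC_add_right[of c x "- y"] by (simp add: scaleC_minus_right)

lemma scaleR_scaleC: "(r *\<^sub>R c) *\<^sub>C x = r *\<^sub>R (c *\<^sub>C (x::'a::complex_vector))"
  by (simp add: scaleR_conv_of_real scaleC_scaleC flip: scaleC_of_real)

lemma star_zero [simp]: "star 0 = (0::'a::cstar_algebra)"
  using star_add[of "0::'a" 0] by simp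

lemma star_scaleR: "star (r *\<^sub>R x) = r *\<^sub>R star (x::'a::cstar_algebra)"
  using star_scaleC[of "complex_of_real r" x] by (simp add: scaleC_of_real)

lemma star_minus: "star (- x) = - star (x::'a::cstar_algebra)"
  using star_scaleR[of "-1" x] by simp

lemma star_diff: "star (x - y) = star x - star (y::'a::cstar_algebra)"
  using star_add[of x "- y"] by (simp add: star_minus)

text \<open>From \<open>\<parallel>x\<parallel>\<^sup>2 = \<parallel>x\<^sup>*x\<parallel> \<le> \<parallel>x\<^sup>*\<parallel> \<parallel>x\<parallel>\<close>.\<close>
lemma norm_le_norm_star: "norm x \<le> norm (star (x::'a::cstar_algebra))"
proof (cases "x = 0")
  case False
  have "norm x * norm x \<le> norm (star x) * norm x"
    using norm_mult_ineq[of "star x" x] by (simp add: cstar_identity power2_eq_square)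
  then show ?thesis using False by simp
qed simp

lemma norm_star [simp]: "norm (star x) = norm (x::'a::cstar_algebra)"
  using norm_le_norm_star[of x] norm_le_norm_star[of "star x"] by (simp add: star_star)

lemma bounded_linear_star: "bounded_linear (star :: 'a::cstar_algebra \<Rightarrow> 'a)"
  by (rule bounded_linear_intro[where K = 1]) (simp_all add: star_add star_scaleR)

lemma norm_selfadjoint_square: "star x = x \<Longrightarrow> norm (x * x) = (norm (x::'a::cstar_algebra))\<^sup>2"
  using cstar_identity[of x] by simp

section \<open>The unitization of a \<open>C\<^sup>*\<close>-algebra\<close>

datatype 'a unitization = Unitize (alg_part: 'a) (scalar_part: complex)

lemma unitization_eq_iff: "x = y \<longleftrightarrow> alg_part x = alg_part y \<and> scalar_part x = scalar_part y"
  using unitization.expand by auto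

instantiation unitization :: (cstar_algebra) complex_vector
begin
definition "0 = Unitize 0 0"
definition "x + y = Unitize (alg_part x + alg_part y) (scalar_part x + scalar_part y)"
definition "- x = Unitize (- alg_part x) (- scalar_part x)"
definition "x - y = Unitize (alg_part x - alg_part y) (scalar_part x - scalar_part y)"
definition "r *\<^sub>R x = Unitize (r *\<^sub>R alg_part x) (r *\<^sub>R scalar_part x)"
definition "c *\<^sub>C x = Unitize (c *\<^sub>C alg_part x) (c * scalar_part x)"
instance
  by standard (auto simp: zero_unitization_def plus_unitization_def uminus_unitization_def
      minus_unitization_def scaleR_unitization_def scaleC_unitization_def unitization_eq_iff
      algebra_simps scaleC_add_right scaleC_add_left scaleC_scaleC scaleC_of_real scaleR_conv_of_real[where 'a=complex])
end

instantiation unitization :: (cstar_algebra) real_algebra_1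
begin
definition "1 = Unitize 0 1"
definition "x * y = Unitize
  (alg_part x * alg_part y + scalar_part x *\<^sub>C alg_part y + scalar_part y *\<^sub>C alg_part x)
  (scalar_part x * scalar_part y)"
instance
  by standard (auto simp: zero_unitization_def plus_unitization_def one_unitization_def
      times_unitization_def scaleR_unitization_def unitization_eq_iff
      algebra_simps scaleC_add_right scaleC_add_left scaleC_scaleC scaleC_scaleR_commute
      scaleC_mult_left scaleC_mult_right scaleR_scaleC)
end

lemma unitization_sel [simp]:
  "alg_part 0 = 0" "scalar_part 0 = 0"
  "alg_part 1 = 0" "scalar_part 1 = 1"
  "alg_part (x + y) = alg_part x + alg_part y" "scalar_part (x + y) = scalar_part x + scalar_part y"
  "alg_part (- x) = - alg_part x" "scalar_part (- x) = - scalar_part x"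
  "alg_part (x - y) = alg_part x - alg_part y" "scalar_part (x - y) = scalar_part x - scalar_part y"
  "alg_part (r *\<^sub>R x) = r *\<^sub>R alg_part x" "scalar_part (r *\<^sub>R x) = r *\<^sub>R scalar_part x"
  "alg_part (c *\<^sub>C x) = c *\<^sub>C alg_part x" "scalar_part (c *\<^sub>C x) = c * scalar_part x"
  "scalar_part (x * y) = scalar_part x * scalar_part y"
  "alg_part (x * y) = alg_part x * alg_part y + scalar_part x *\<^sub>C alg_part y + scalar_part y *\<^sub>C alg_part x"
  for x y :: "'a::cstar_algebra unitization"
  by (simp_all add: zero_unitization_def plus_unitization_def one_unitization_def
      times_unitization_def scaleR_unitization_def uminus_unitization_def
      minus_unitization_def scaleC_unitization_def)

text \<open>The element \<open>(a, \<lambda>)\<close> acts on the original algebra as the operator \<open>y \<mapsto> ay + \<lambda>y\<close>.  Its operator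
  norm is only a seminorm when the algebra already has a unit, since \<open>(1, -1)\<close> then acts as zero.  The
  norm of the unitization is therefore the maximum of this operator norm and \<open>|\<lambda>|\<close>, which is a
  \<open>C\<^sup>*\<close>-norm in every case and makes \<open>scalar_part\<close> a continuous character.\<close>
definition left_mult :: "'a::cstar_algebra unitization \<Rightarrow> 'a \<Rightarrow>\<^sub>L 'a" where
  "left_mult x = Blinfun (\<lambda>y. alg_part x * y + scalar_part x *\<^sub>C y)"

lemma left_mult_apply: "left_mult x y = alg_part x * y + scalar_part x *\<^sub>C y"
proof -
  have "bounded_linear (\<lambda>y. alg_part x * y + scalar_part x *\<^sub>C y)"
  proof (rule bounded_linear_intro[where K = "norm (alg_part x) + cmod (scalar_part x)"])
    fix y
    have "norm (alg_part x * y + scalar_part x *\<^sub>C y)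
        \<le> norm (alg_part x * y) + norm (scalar_part x *\<^sub>C y)"
      by (rule norm_triangle_ineq)
    then show "norm (alg_part x * y + scalar_part x *\<^sub>C y)
        \<le> norm y * (norm (alg_part x) + cmod (scalar_part x))"
      using norm_mult_ineq[of "alg_part x" y] by (simp add: norm_scaleC algebra_simps)
  qed (simp_all add: algebra_simps scaleC_add_right scaleC_scaleR_commute)
  then show ?thesis
    by (simp add: left_mult_def bounded_linear_Blinfun_apply)
qed

lemma left_mult_add: "left_mult (x + y) = left_mult x + left_mult y"
  by (rule blinfun_eqI) (simp add: left_mult_apply blinfun.add_left scaleC_add_left algebra_simps)

lemma left_mult_scaleC: "left_mult (c *\<^sub>C x) = c *\<^sub>C left_mult x"
  by (rule blinfun_eqI)
    (simp add: left_mult_apply blinfun_apply_scaleC scaleC_scaleC scaleC_add_right scaleC_mult_left)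

lemma left_mult_mult: "left_mult (x * y) = left_mult x o\<^sub>L left_mult y"
  by (rule blinfun_eqI)
    (simp add: left_mult_apply algebra_simps scaleC_scaleC scaleC_add_right scaleC_mult_left
      scaleC_mult_right)

lemma left_mult_scaleR: "left_mult (r *\<^sub>R x) = r *\<^sub>R left_mult x"
  using left_mult_scaleC[of "complex_of_real r" x] by (simp only: scaleC_of_real)

text \<open>The \<open>C\<^sup>*\<close>-identity makes left multiplication isometric: testing on \<open>y = a\<^sup>*\<close> recovers \<open>\<parallel>a\<parallel>\<close>.\<close>
lemma cstar_norm_le:
  fixes a :: "'a::cstar_algebra"
  assumes K: "0 \<le> K" and *: "\<And>y. norm (a * y) \<le> K * norm y"
  shows "norm a \<le> K"
proof (cases "a = 0")
  case False
  have "norm a * norm a \<le> K * norm a"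
    using *[of "star a"] cstar_identity[of "star a"] by (simp add: star_star power2_eq_square)
  then show ?thesis using False by simp
qed (use K in simp)

lemma max_mult_nonneg: "0 \<le> r \<Longrightarrow> max (r * a) (r * b) = r * max a (b::real)"
  by (rule max_of_mono) (simp add: mono_def mult_left_mono)

instantiation unitization :: (cstar_algebra) real_normed_algebra_1
begin
definition "norm x = max (norm (left_mult x)) (cmod (scalar_part x))"
definition "dist x y = norm (x - y)" for x y :: "'a unitization"
definition "sgn x = inverse (norm x) *\<^sub>R x" for x :: "'a unitization"
definition "uniformity =
  (INF e\<in>{0<..}. principal {(x, y :: 'a unitization). dist x y < e})"
definition "open (S :: 'a unitization set) \<longleftrightarrow>
  (\<forall>x\<in>S. \<forall>\<^sub>F (x', y) in uniformity. x' = x \<longrightarrow> y \<in> S)"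

instance
proof
  fix x y :: "'a unitization" and r :: real
  show "(norm x = 0) = (x = 0)"
  proof
    assume "norm x = 0"
    then have l: "left_mult x = 0" and s: "scalar_part x = 0"
      by (auto simp: norm_unitization_def max_def split: if_splits)
    have "alg_part x * y = 0" for y
      using left_mult_apply[of x y] by (simp add: l s)
    then have "norm (alg_part x * y) \<le> 0 * norm y" for y by simp
    then have "norm (alg_part x) \<le> 0"
      by (rule cstar_norm_le[OF order.refl])
    then show "x = 0" by (simp add: unitization_eq_iff s)
  next
    assume "x = 0"
    then show "norm x = 0"
      using left_mult_scaleR[of 0 0] by (simp add: norm_unitization_def)
  qed
  show "norm (x + y) \<le> norm x + norm y"
    using norm_triangle_ineq[of "left_mult x" "left_mult y"]
      norm_triangle_ineq[of "scalar_part x" "scalar_part y"]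
    by (auto simp: norm_unitization_def left_mult_add)
  show "norm (r *\<^sub>R x) = \<bar>r\<bar> * norm x"
    using max_mult_nonneg[of "\<bar>r\<bar>" "norm (left_mult x)" "cmod (scalar_part x)"]
    by (simp add: norm_unitization_def left_mult_scaleR)
  have "norm (left_mult x o\<^sub>L left_mult y) \<le> norm (left_mult x) * norm (left_mult y)"
    by (rule norm_blinfun_compose)
  also have "\<dots> \<le> norm x * norm y"
    by (intro mult_mono) (auto simp: norm_unitization_def le_max_iff_disj)
  finally have 1: "norm (left_mult (x * y)) \<le> norm x * norm y"
    by (simp add: left_mult_mult)
  have "cmod (scalar_part x) * cmod (scalar_part y) \<le> norm x * norm y"
    by (intro mult_mono) (auto simp: norm_unitization_def le_max_iff_disj)
  with 1 show "norm (x * y) \<le> norm x * norm y"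
    by (simp add: norm_unitization_def[of "x * y"] norm_mult)
  have "norm (left_mult 1 y) \<le> 1 * norm y" for y :: 'a
    by (simp add: left_mult_apply)
  then have "norm (left_mult (1 :: 'a unitization)) \<le> 1"
    by (intro norm_blinfun_bound) auto
  then show "norm (1 :: 'a unitization) = 1"
    by (simp add: norm_unitization_def max_def)
qed (simp_all add: dist_unitization_def sgn_unitization_def uniformity_unitization_def
    open_unitization_def)
end

lemma norm_scalar_part_le: "cmod (scalar_part x) \<le> norm x"
  by (simp add: norm_unitization_def)

lemma norm_alg_part_le: "norm (alg_part x) \<le> 2 * norm (x :: 'a::cstar_algebra unitization)"
proof (rule cstar_norm_le)
  fix y :: 'a
  have "norm (alg_part x * y) \<le> norm (left_mult x y) + norm (scalar_part x *\<^sub>C y)"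
    using norm_triangle_ineq4[of "left_mult x y" "scalar_part x *\<^sub>C y"] by (simp add: left_mult_apply)
  also have "norm (left_mult x y) \<le> norm x * norm y"
    using norm_blinfun[of "left_mult x" y]
      mult_right_mono[of "norm (left_mult x)" "norm x" "norm y"]
    by (simp add: norm_unitization_def)
  also have "norm (scalar_part x *\<^sub>C y) \<le> norm x * norm y"
    using mult_right_mono[OF norm_scalar_part_le[of x], of "norm y"] by (simp add: norm_scaleC)
  finally show "norm (alg_part x * y) \<le> 2 * norm x * norm y" by (simp add: mult_ac)
qed simp

lemma norm_left_mult_le: "norm (left_mult x) \<le> norm (alg_part x) + cmod (scalar_part x)"
proof (rule norm_blinfun_bound)
  fix y
  have "norm (left_mult x y) \<le> norm (alg_part x * y) + norm (scalar_part x *\<^sub>C y)"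
    by (simp add: left_mult_apply norm_triangle_ineq)
  then show "norm (left_mult x y) \<le> (norm (alg_part x) + cmod (scalar_part x)) * norm y"
    using norm_mult_ineq[of "alg_part x" y] by (simp add: norm_scaleC algebra_simps)
qed simp

lemma norm_unitization_le: "norm x \<le> norm (alg_part x) + cmod (scalar_part x)"
  using norm_left_mult_le[of x] by (simp add: norm_unitization_def)

lemma bounded_linear_alg_part: "bounded_linear (alg_part :: 'a::cstar_algebra unitization \<Rightarrow> 'a)"
  by (rule bounded_linear_intro[where K = 2]) (use norm_alg_part_le in \<open>auto simp: mult.commute\<close>)

lemma bounded_linear_scalar_part:
  "bounded_linear (scalar_part :: 'a::cstar_algebra unitization \<Rightarrow> complex)"
  by (rule bounded_linear_intro[where K = 1]) (use norm_scalar_part_le in auto)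

instantiation unitization :: (cstar_algebra) cstar_algebra
begin
definition "star x = Unitize (star (alg_part x)) (cnj (scalar_part x))"

instance
proof
  show "convergent X" if X: "Cauchy X" for X :: "nat \<Rightarrow> 'a unitization"
  proof -
    have "Cauchy (\<lambda>n. alg_part (X n))" "Cauchy (\<lambda>n. scalar_part (X n))"
      using bounded_linear.Cauchy[OF bounded_linear_alg_part X]
        bounded_linear.Cauchy[OF bounded_linear_scalar_part X] by auto
    then obtain a c where "(\<lambda>n. alg_part (X n)) \<longlonglongrightarrow> a" "(\<lambda>n. scalar_part (X n)) \<longlonglongrightarrow> c"
      using Cauchy_convergent_iff convergent_def by metis
    then have "(\<lambda>n. norm (alg_part (X n) - a) + norm (scalar_part (X n) - c)) \<longlonglongrightarrow> 0"
      by (auto intro!: tendsto_eq_intros)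
    then have "(\<lambda>n. X n - Unitize a c) \<longlonglongrightarrow> 0"
    proof (rule Lim_null_comparison[rotated], intro always_eventually allI)
      show "norm (X n - Unitize a c) \<le> norm (alg_part (X n) - a) + norm (scalar_part (X n) - c)" for n
        using norm_unitization_le[of "X n - Unitize a c"] by simp
    qed
    then show ?thesis
      unfolding convergent_def LIM_zero_iff by blast
  qed
  fix x y :: "'a unitization" and c :: complex
  have "norm (left_mult (c *\<^sub>C x)) = cmod c * norm (left_mult x)"
  proof -
    have le: "norm (d *\<^sub>C T) \<le> cmod d * norm T" for d :: complex and T :: "'a \<Rightarrow>\<^sub>L 'a"
    proof (rule norm_blinfun_bound)
      show "norm ((d *\<^sub>C T) y) \<le> cmod d * norm T * norm y" for y
        using mult_left_mono[OF norm_blinfun[of T y], of "cmod d"]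
        by (simp add: blinfun_apply_scaleC norm_scaleC mult_ac)
    qed simp
    show ?thesis
    proof (cases "c = 0")
      case True
      then show ?thesis using left_mult_scaleR[of 0 x] by simp
    next
      case False
      then have "inverse c *\<^sub>C (c *\<^sub>C left_mult x) = left_mult x" by (simp add: scaleC_scaleC)
      then have "norm (left_mult x) \<le> cmod (inverse c) * norm (c *\<^sub>C left_mult x)"
        using le[of "inverse c" "c *\<^sub>C left_mult x"] by simp
      then have "cmod c * norm (left_mult x) \<le> norm (c *\<^sub>C left_mult x)"
        using False by (simp add: norm_divide field_simps)
      with le[of c "left_mult x"] show ?thesis by (simp add: left_mult_scaleC)
    qed
  qed
  then show "norm (c *\<^sub>C x) = cmod c * norm x"
    using max_mult_nonneg[of "cmod c" "norm (left_mult x)" "cmod (scalar_part x)"]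
    by (simp add: norm_unitization_def norm_mult)
  show "(c *\<^sub>C x) * y = c *\<^sub>C (x * y)" "x * (c *\<^sub>C y) = c *\<^sub>C (x * y)"
    by (simp_all add: unitization_eq_iff scaleC_mult_left scaleC_mult_right scaleC_add_right
        scaleC_scaleC mult_ac)
  show "star (x + y) = star x + star y" "star (c *\<^sub>C x) = cnj c *\<^sub>C star x"
    "star (x * y) = star y * star x" "star (star x) = x"
    by (simp_all add: star_unitization_def unitization_eq_iff star_add star_scaleC star_mult
        star_star)
  have lower: "(norm z)\<^sup>2 \<le> norm (star z * z)" for z :: "'a unitization"
  proof -
    have "norm (left_mult z) \<le> sqrt (norm (left_mult (star z * z)))"
    proof (rule norm_blinfun_bound)
      fix y
      \<comment> \<open>The \<open>C\<^sup>*\<close>-identity of the original algebra, applied to the value \<open>zy\<close>.\<close>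
      have "star (left_mult z y) * left_mult z y = star y * left_mult (star z * z) y"
        by (simp add: left_mult_apply star_unitization_def star_add star_mult star_scaleC algebra_simps
            scaleC_mult_left scaleC_mult_right scaleC_add_right scaleC_scaleC scaleC_add_left)
      then have "(norm (left_mult z y))\<^sup>2 = norm (star y * left_mult (star z * z) y)"
        by (metis cstar_identity)
      also have "\<dots> \<le> norm (star y) * norm (left_mult (star z * z) y)"
        by (rule norm_mult_ineq)
      also have "\<dots> \<le> norm y * (norm (left_mult (star z * z)) * norm y)"
        by (simp add: mult_left_mono norm_blinfun)
      also have "\<dots> = (sqrt (norm (left_mult (star z * z))) * norm y)\<^sup>2"
        by (simp add: power2_eq_square algebra_simps)
      finally show "norm (left_mult z y) \<le> sqrt (norm (left_mult (star z * z))) * norm y"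
        by (rule power2_le_imp_le) simp
    qed simp
    then have "(norm (left_mult z))\<^sup>2 \<le> norm (left_mult (star z * z))"
      using real_sqrt_le_iff sqrt_ge_absD by fastforce
    moreover have "(cmod (scalar_part z))\<^sup>2 = cmod (scalar_part (star z * z))"
      by (simp add: star_unitization_def norm_mult power2_eq_square)
    ultimately show ?thesis
      by (auto simp: norm_unitization_def max_def)
  qed
  have "norm z \<le> norm (star z)" for z :: "'a unitization"
  proof (cases "z = 0")
    case False
    have "norm z * norm z \<le> norm (star z) * norm z"
      using lower[of z] norm_mult_ineq[of "star z" z] by (simp add: power2_eq_square)
    then show ?thesis using False by simp
  qed simp
  from this[of "star x"] have "norm (star x) \<le> norm x"
    by (simp add: star_unitization_def unitization_eq_iff star_star)
  then have "norm (star x * x) \<le> norm x * norm x"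
    using norm_mult_ineq[of "star x" x] mult_right_mono[of _ _ "norm x"] by fastforce
  with lower[of x] show "norm (star x * x) = (norm x)\<^sup>2"
    by (simp add: power2_eq_square)
qed
end

lemma star_one [simp]: "star 1 = (1::'a::{cstar_algebra,real_normed_algebra_1})"
  by (metis mult.left_neutral mult.right_neutral star_mult star_star)

definition embed :: "'a::cstar_algebra \<Rightarrow> 'a unitization" where
  "embed a = Unitize a 0"

lemma embed_sel [simp]: "alg_part (embed a) = a" "scalar_part (embed a) = 0"
  by (simp_all add: embed_def)

lemma embed_mult: "embed (a * b) = embed a * embed b"
  and embed_add: "embed (a + b) = embed a + embed b"
  and embed_diff: "embed (a - b) = embed a - embed b"
  and embed_scaleR: "embed (r *\<^sub>R a) = r *\<^sub>R embed a"
  and embed_star: "embed (star a) = star (embed a)"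
  by (simp_all add: unitization_eq_iff star_unitization_def)

lemma embed_alg_part: "scalar_part x = 0 \<Longrightarrow> embed (alg_part x) = x"
  by (simp add: unitization_eq_iff)

lemma norm_embed [simp]: "norm (embed a) = norm a"
proof (rule antisym)
  show "norm (embed a) \<le> norm a" using norm_unitization_le[of "embed a"] by simp
  show "norm a \<le> norm (embed a)"
  proof (rule cstar_norm_le)
    fix y
    have "norm (left_mult (embed a) y) \<le> norm (left_mult (embed a)) * norm y"
      by (rule norm_blinfun)
    also have "\<dots> \<le> norm (embed a) * norm y"
      by (intro mult_right_mono) (auto simp: norm_unitization_def)
    finally show "norm (a * y) \<le> norm (embed a) * norm y" by (simp add: left_mult_apply)
  qed simp
qed

section \<open>Square roots by successive approximation\<close>

text \<open>The fixed points of \<open>s \<mapsto> (u + s\<^sup>2)/2\<close> are the solutions of \<open>(1 - s)\<^sup>2 = 1 - u\<close>.  The scalar iteration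
  with \<open>u = 1\<close> increases and is bounded by 1; it serves as a majorant for all \<open>u\<close> of norm at most 1.\<close>
fun root_iter :: "'a::real_algebra_1 \<Rightarrow> nat \<Rightarrow> 'a" where
  "root_iter u 0 = 0"
| "root_iter u (Suc n) = (1/2) *\<^sub>R (u + root_iter u n * root_iter u n)"

lemma root_iter_commute: "root_iter u n * u = u * root_iter u n"
proof (induction n)
  case (Suc n)
  have "root_iter u n * root_iter u n * u = u * (root_iter u n * root_iter u n)"
    by (metis Suc mult.assoc)
  then show ?case by (simp add: distrib_left distrib_right)
qed simp

lemma root_iter_commute2: "root_iter u n * root_iter u m = root_iter u m * root_iter u n"
proof (induction n)
  case (Suc n)
  have "root_iter u n * root_iter u n * root_iter u m = root_iter u m * (root_iter u n * root_iter u n)"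
    by (metis Suc mult.assoc)
  then show ?case by (simp add: distrib_left distrib_right root_iter_commute)
qed simp

lemma root_iter_real:
  "0 \<le> root_iter (1::real) n" "root_iter (1::real) n \<le> 1"
  by (induction n) (auto simp: mult_le_one)

lemma root_iter_real_mono: "root_iter (1::real) n \<le> root_iter 1 (Suc n)"
proof -
  have "0 \<le> (1 - root_iter (1::real) n)\<^sup>2" by simp
  then show ?thesis by (simp add: power2_eq_square algebra_simps)
qed

lemma norm_root_iter_le:
  fixes u :: "'a::real_normed_algebra_1"
  assumes "norm u \<le> 1"
  shows "norm (root_iter u n) \<le> root_iter 1 n"
proof (induction n)
  case (Suc n)
  have "norm (root_iter u n * root_iter u n) \<le> root_iter 1 n * root_iter 1 n"
    using Suc by (intro order_trans[OF norm_mult_ineq] mult_mono) (auto simp: root_iter_real)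
  then show ?case
    using norm_triangle_ineq[of u "root_iter u n * root_iter u n"] assms by simp
qed simp

text \<open>All iterates commute, so with \<open>a = s\<^sub>n\<^sub>+\<^sub>1\<close> and \<open>b = s\<^sub>n\<close> consecutive increments are related by
  \<open>(a\<^sup>2 - b\<^sup>2)/2 = (a - b)(a + b)/2\<close>, and each factor is dominated by its scalar counterpart.\<close>
lemma norm_root_iter_diff_le:
  fixes u :: "'a::real_normed_algebra_1"
  assumes u: "norm u \<le> 1"
  shows "norm (root_iter u (Suc n) - root_iter u n) \<le> root_iter 1 (Suc n) - root_iter 1 n"
proof (induction n)
  case 0
  then show ?case using u by simp
next
  case (Suc n)
  define a b where "a = root_iter u (Suc n)" and "b = root_iter u n"
  define s t where "s = root_iter (1::real) (Suc n)" and "t = root_iter (1::real) n"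
  have ba: "b * a = a * b" unfolding a_def b_def by (rule root_iter_commute2)
  have "root_iter u (Suc (Suc n)) = (1/2) *\<^sub>R (u + a * a)"
    unfolding a_def by (rule root_iter.simps)
  moreover have "a = (1/2) *\<^sub>R (u + b * b)"
    unfolding a_def b_def by (rule root_iter.simps)
  ultimately have "root_iter u (Suc (Suc n)) - a = (1/2) *\<^sub>R (a * a - b * b)"
    by (simp add: scaleR_right_distrib scaleR_right_diff_distrib)
  also have "a * a - b * b = (a - b) * (a + b)"
    by (simp add: algebra_simps ba)
  finally have "norm (root_iter u (Suc (Suc n)) - a) \<le> (1/2) * (norm (a - b) * norm (a + b))"
    using norm_mult_ineq[of "a - b" "a + b"] by simp
  also have "norm (a - b) * norm (a + b) \<le> (s - t) * (s + t)"
  proof (rule mult_mono)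
    show "norm (a - b) \<le> s - t" using Suc unfolding a_def b_def s_def t_def .
    show "norm (a + b) \<le> s + t"
      unfolding a_def b_def s_def t_def
      by (rule norm_triangle_le[OF add_mono]) (rule norm_root_iter_le[OF u])+
    show "0 \<le> s - t" using root_iter_real_mono[of n] by (simp add: s_def t_def)
  qed simp
  also have "(1/2) * ((s - t) * (s + t)) = (1/2) * (1 + s * s) - (1/2) * (1 + t * t)"
    by (simp add: algebra_simps)
  also have "(1/2) * (1 + s * s) = root_iter 1 (Suc (Suc n))"
    unfolding s_def by (subst (3) root_iter.simps) simp
  also have "(1/2) * (1 + t * t) = s"
    unfolding s_def t_def by simp
  finally show ?case by (simp add: a_def s_def)
qed

lemma root_iter_convergent:
  fixes u :: "'a::{real_normed_algebra_1,banach}"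
  assumes u: "norm u \<le> 1"
  obtains s where "root_iter u \<longlonglongrightarrow> s"
proof -
  have "incseq (root_iter (1::real))"
    using root_iter_real_mono by (rule incseq_SucI)
  then obtain L where L: "root_iter (1::real) \<longlonglongrightarrow> L"
    using incseq_convergent[of "root_iter (1::real)" 1] root_iter_real(2) by metis
  have "summable (\<lambda>n. root_iter 1 (Suc n) - root_iter (1::real) n)"
    using telescope_sums[OF L] by (rule sums_summable)
  then have "summable (\<lambda>n. root_iter u (Suc n) - root_iter u n)"
    using norm_root_iter_diff_le[OF u] by (rule summable_comparison_test')
  then have "convergent (\<lambda>N. \<Sum>n<N. root_iter u (Suc n) - root_iter u n)"
    by (simp add: summable_iff_convergent)
  then have "convergent (root_iter u)"
    by (simp add: sum_lessThan_telescope del: root_iter.simps(2))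
  then show ?thesis using that by (auto simp: convergent_def)
qed

text \<open>Sets that contain every limit of the square root iteration as soon as they contain its starting
  datum.  Only squares of single elements are required to stay in the set, so that the notion covers
  closed unital subalgebras and commutants, but also the set of self-adjoint elements, which is not
  closed under products.\<close>
definition jordan_closed :: "'a::real_normed_algebra_1 set \<Rightarrow> bool" where
  "jordan_closed S \<longleftrightarrow> closed S \<and> 1 \<in> S \<and> (\<forall>x\<in>S. \<forall>y\<in>S. x + y \<in> S) \<and>
     (\<forall>r. \<forall>x\<in>S. r *\<^sub>R x \<in> S) \<and> (\<forall>x\<in>S. x * x \<in> S)"

lemma jordan_closed_diff: "jordan_closed S \<Longrightarrow> x \<in> S \<Longrightarrow> y \<in> S \<Longrightarrow> x - y \<in> S"
  unfolding jordan_closed_def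
  by (metis scaleR_minus1_left uminus_add_conv_diff add.commute)

lemma root_iter_in: "jordan_closed S \<Longrightarrow> u \<in> S \<Longrightarrow> root_iter u n \<in> S"
proof (induction n)
  case 0
  then have "0 *\<^sub>R 1 \<in> S" unfolding jordan_closed_def by blast
  then show ?case by simp
next
  case (Suc n)
  then show ?case by (auto simp: jordan_closed_def)
qed

text \<open>The last property replaces functional calculus: the root inherits from \<open>u\<close> self-adjointness,
  membership in closed subalgebras, and commutation with any given element.\<close>
lemma sqrt_one_minus:
  fixes u :: "'a::{real_normed_algebra_1,banach}"
  assumes u: "norm u \<le> 1"
  obtains r where "r * r = 1 - u" "norm (1 - r) \<le> 1"
    "\<And>S. jordan_closed S \<Longrightarrow> u \<in> S \<Longrightarrow> r \<in> S"
proof -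
  obtain s where s: "root_iter u \<longlonglongrightarrow> s" using root_iter_convergent[OF u] .
  have "(\<lambda>n. root_iter u (Suc n)) \<longlonglongrightarrow> (1/2) *\<^sub>R (u + s * s)"
    unfolding root_iter.simps by (intro tendsto_intros s)
  with LIMSEQ_Suc[OF s] have "s = (1/2) *\<^sub>R (u + s * s)"
    by (rule LIMSEQ_unique)
  then have "2 *\<^sub>R s = u + s * s" by (metis scaleR_scaleR scaleR_one field_sum_of_halves mult_2 nonzero_mult_div_cancel_left one_neq_zero times_divide_eq_right zero_neq_numeral)
  then have "(1 - s) * (1 - s) = 1 - u"
    by (simp add: algebra_simps scaleR_2)
  moreover have "norm (1 - (1 - s)) \<le> 1"
  proof -
    have "norm (root_iter u n) \<le> 1" for n
      using norm_root_iter_le[OF u] root_iter_real(2) by (rule order_trans)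
    then have "norm s \<le> 1"
      by (intro LIMSEQ_le_const2[OF tendsto_norm[OF s]]) auto
    then show ?thesis by simp
  qed
  moreover have "1 - s \<in> S" if S: "jordan_closed S" "u \<in> S" for S
  proof -
    have "s \<in> S"
      using closed_sequentially[of S "root_iter u" s] S root_iter_in[OF S] s
      by (auto simp: jordan_closed_def)
    with S show ?thesis using jordan_closed_diff by (auto simp: jordan_closed_def)
  qed
  ultimately show ?thesis using that by blast
qed

lemma jordan_closed_commutant: "jordan_closed {x. x * y = y * (x::'a::real_normed_algebra_1)}"
  unfolding jordan_closed_def
proof (intro conjI)
  show "closed {x. x * y = y * x}"
    by (intro closed_Collect_eq continuous_intros)
qed (auto simp: algebra_simps, metis mult.assoc)

lemma jordan_closed_selfadjoint:
  "jordan_closed {x. star x = (x::'a::{cstar_algebra,real_normed_algebra_1})}"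
  unfolding jordan_closed_def
proof (intro conjI)
  show "closed {x. star x = (x::'a)}"
    by (intro closed_Collect_eq continuous_intros linear_continuous_on bounded_linear_star)
qed (auto simp: star_add star_scaleR star_mult)

section \<open>The positive cone of a unital \<open>C\<^sup>*\<close>-algebra\<close>

text \<open>Positivity expressed through the norm alone: by spectral theory, \<open>\<parallel>t - h\<parallel> \<le> t\<close> says that the
  spectrum of \<open>h\<close> lies in \<open>[0, 2t]\<close>.  The triangle inequality turns this into a convex cone.\<close>
definition cpos :: "'a::{cstar_algebra,real_normed_algebra_1} \<Rightarrow> bool" where
  "cpos h \<longleftrightarrow> star h = h \<and> (\<exists>t\<ge>0. norm (t *\<^sub>R 1 - h) \<le> t)"

lemma cpos_star: "cpos h \<Longrightarrow> star h = h"
  by (simp add: cpos_def)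

lemma cposI: "star h = h \<Longrightarrow> norm (1 - h) \<le> 1 \<Longrightarrow> cpos h"
  unfolding cpos_def by (metis scaleR_one zero_le_one)

lemma cpos_add: assumes "cpos h" "cpos k" shows "cpos (h + k)"
proof -
  obtain s t where st: "0 \<le> s" "norm (s *\<^sub>R 1 - h) \<le> s" "0 \<le> t" "norm (t *\<^sub>R 1 - k) \<le> t"
    using assms unfolding cpos_def by blast
  have "norm ((s + t) *\<^sub>R 1 - (h + k)) \<le> s + t"
    using norm_triangle_ineq[of "s *\<^sub>R 1 - h" "t *\<^sub>R 1 - k"] st by (simp add: algebra_simps)
  with st assms show ?thesis
    unfolding cpos_def by (intro conjI exI[of _ "s + t"]) (auto simp: star_add)
qed

lemma cpos_scaleR: assumes "cpos h" "0 \<le> r" shows "cpos (r *\<^sub>R h)"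
proof -
  obtain t where t: "0 \<le> t" "norm (t *\<^sub>R 1 - h) \<le> t" using assms unfolding cpos_def by blast
  have "norm ((r * t) *\<^sub>R 1 - r *\<^sub>R h) = r * norm (t *\<^sub>R 1 - h)"
    using assms by (simp flip: scaleR_scaleR scaleR_right_diff_distrib)
  with t assms show ?thesis
    unfolding cpos_def by (intro conjI exI[of _ "r * t"]) (auto simp: star_scaleR mult_left_mono)
qed

lemma cpos_scaleR_iff: "0 < r \<Longrightarrow> cpos (r *\<^sub>R h) \<longleftrightarrow> cpos h"
  using cpos_scaleR[of h r] cpos_scaleR[of "r *\<^sub>R h" "1/r"] by auto

lemma cpos_one: "cpos (1::'a::{cstar_algebra,real_normed_algebra_1})"
  by (rule cposI) auto

lemma cpos_zero: "cpos (0::'a::{cstar_algebra,real_normed_algebra_1})"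
  by (rule cposI) auto

text \<open>Rescaling gives \<open>h/t = 1 - u\<close> with \<open>\<parallel>u\<parallel> \<le> 1\<close>.\<close>
lemma cpos_sqrt:
  assumes h: "cpos h"
  obtains r where "cpos r" "r * r = h" "\<And>S. jordan_closed S \<Longrightarrow> h \<in> S \<Longrightarrow> r \<in> S"
proof (cases "h = 0")
  case True
  show ?thesis
  proof (rule that[of 0])
    show "0 \<in> S" if "jordan_closed S" "h \<in> S" for S using that True by simp
  qed (use True cpos_zero in auto)
next
  case False
  obtain t where t: "0 \<le> t" "norm (t *\<^sub>R 1 - h) \<le> t" using h unfolding cpos_def by blast
  with False have t0: "t > 0" by (cases "t = 0") auto
  define u where "u = 1 - (1/t) *\<^sub>R h"
  have "u = (1/t) *\<^sub>R (t *\<^sub>R 1 - h)" using t0 by (simp add: u_def scaleR_right_diff_distrib)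
  then have "norm u \<le> 1" using t t0 by simp
  then obtain r where r: "r * r = 1 - u" "norm (1 - r) \<le> 1"
    "\<And>S. jordan_closed S \<Longrightarrow> u \<in> S \<Longrightarrow> r \<in> S" using sqrt_one_minus by blast
  have uS: "u \<in> S" if "jordan_closed S" "h \<in> S" for S
    using that jordan_closed_diff[OF that(1)] unfolding u_def by (auto simp: jordan_closed_def)
  show ?thesis
  proof (rule that[of "sqrt t *\<^sub>R r"])
    have "star r = r" using r(3)[OF jordan_closed_selfadjoint uS[OF jordan_closed_selfadjoint]]
        cpos_star[OF h] by simp
    then show "cpos (sqrt t *\<^sub>R r)" using r(2) t by (intro cpos_scaleR cposI) auto
    show "sqrt t *\<^sub>R r * sqrt t *\<^sub>R r = h" using r(1) t0 by (simp add: u_def)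
    show "sqrt t *\<^sub>R r \<in> S" if "jordan_closed S" "h \<in> S" for S
      using r(3)[OF that(1) uS[OF that]] that by (auto simp: jordan_closed_def)
  qed
qed

text \<open>The element \<open>x + iy\<close> is unitary, and \<open>x\<close> is its real part.\<close>
lemma norm_le_one_of_squares:
  fixes x y :: "'a::{cstar_algebra,real_normed_algebra_1}"
  assumes x: "star x = x" and y: "star y = y" and xy: "x * y = y * x" and 1: "x * x + y * y = 1"
  shows "norm x \<le> 1"
proof -
  define w where "w = x + \<i> *\<^sub>C y"
  have sw: "star w = x - \<i> *\<^sub>C y"
    by (simp add: w_def star_add star_scaleC x y scaleC_minus_left)
  have "star w * w = x * x + y * y"
    unfolding sw unfolding w_def
    by (simp add: algebra_simps scaleC_mult_left scaleC_mult_right scaleC_scaleC scaleC_minus_left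
        scaleC_diff_right scaleC_add_right xy)
  then have "(norm w)\<^sup>2 = 1" by (metis 1 cstar_identity norm_one)
  then have nw: "norm w = 1" using norm_ge_zero[of w] by (auto simp: power2_eq_1_iff simp del: norm_ge_zero)
  have "w + star w = 2 *\<^sub>R x" unfolding sw unfolding w_def by (simp add: scaleR_2)
  then show ?thesis
    using norm_triangle_ineq[of w "star w"] nw by simp
qed

text \<open>Take \<open>s = \<surd>(1 - x\<^sup>2)\<close>: then \<open>x\<^sup>2 + s\<^sup>2 = 1\<close> gives \<open>\<parallel>s\<parallel> \<le> 1\<close>, and \<open>1 - x\<^sup>2 = s\<^sup>2\<close>.\<close>
lemma norm_square_complement:
  fixes x :: "'a::{cstar_algebra,real_normed_algebra_1}"
  assumes x: "star x = x" and n: "norm x \<le> 1"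
  shows "norm (1 - x * x) \<le> 1"
proof -
  have "norm (x * x) \<le> 1"
    using n by (simp add: norm_selfadjoint_square[OF x] power_le_one)
  then obtain s where s: "s * s = 1 - x * x"
    "\<And>S. jordan_closed S \<Longrightarrow> x * x \<in> S \<Longrightarrow> s \<in> S" using sqrt_one_minus by metis
  have ss: "star s = s" using s(2)[OF jordan_closed_selfadjoint] x by (simp add: star_mult)
  have sx: "s * x = x * s" using s(2)[OF jordan_closed_commutant[of x]] by (simp add: mult.assoc)
  have "norm s \<le> 1"
    by (rule norm_le_one_of_squares[OF ss x sx]) (simp add: s(1))
  then show ?thesis
    using norm_selfadjoint_square[OF ss] s(1) by (simp add: power_le_one)
qed

lemma cpos_square:
  assumes x: "star x = x"
  shows "cpos (x * x)"
proof (cases "x = 0")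
  case False
  define y where "y = (1 / norm x) *\<^sub>R x"
  have y: "star y = y" "norm y \<le> 1" using x by (auto simp: y_def star_scaleR)
  have "cpos (y * y)"
    by (rule cposI[OF _ norm_square_complement[OF y]]) (simp add: star_mult y)
  then have "cpos ((1 / (norm x)\<^sup>2) *\<^sub>R (x * x))" by (simp add: y_def power2_eq_square)
  then show ?thesis using False by (subst (asm) cpos_scaleR_iff) auto
qed (simp add: cpos_zero)

text \<open>The bound in the definition of positivity holds uniformly for all \<open>t \<ge> \<parallel>h\<parallel>\<close>, because \<open>h/t\<close> is the
  square of a self-adjoint contraction.  This uniformity makes the cone closed.\<close>
lemma cpos_norm_le:
  assumes h: "cpos h" and t: "norm h \<le> t"
  shows "norm (t *\<^sub>R 1 - h) \<le> t"
proof (cases "t = 0")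
  case False
  then have t0: "t > 0" using t norm_ge_zero[of h] by linarith
  obtain r where r: "cpos r" "r * r = h" using cpos_sqrt[OF h] by blast
  define y where "y = (1 / sqrt t) *\<^sub>R r"
  have y: "star y = y" using cpos_star[OF r(1)] by (simp add: y_def star_scaleR)
  have yy: "y * y = (1/t) *\<^sub>R h" using r(2) t0 by (simp add: y_def)
  have "(norm y)\<^sup>2 = norm h / t"
    using norm_selfadjoint_square[OF y] t0 by (simp add: yy)
  also have "\<dots> \<le> 1" using t t0 by (simp add: divide_le_eq)
  finally have "(norm y)\<^sup>2 \<le> 1" .
  then have "norm y \<le> 1" by (simp add: power_le_one_iff)
  then have "norm (1 - (1/t) *\<^sub>R h) \<le> 1" using norm_square_complement[OF y] yy by simp
  moreover have "t *\<^sub>R 1 - h = t *\<^sub>R (1 - (1/t) *\<^sub>R h)" using t0 by (simp add: scaleR_right_diff_distrib)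
  ultimately show ?thesis using t0 by simp
qed (use t in auto)

lemma closed_cpos: "closed {h. cpos h}"
  unfolding closed_sequential_limits
proof (intro allI impI)
  fix X and l :: 'a
  assume "(\<forall>n. X n \<in> {h. cpos h}) \<and> X \<longlonglongrightarrow> l"
  then have X: "\<And>n. cpos (X n)" and l: "X \<longlonglongrightarrow> l" by auto
  have "star l = l"
    using LIMSEQ_unique[OF bounded_linear.tendsto[OF bounded_linear_star l]] l X
    by (auto simp: cpos_star)
  moreover have "norm (norm l *\<^sub>R 1 - l) \<le> norm l"
  proof (rule LIMSEQ_le)
    show "(\<lambda>n. norm (norm (X n) *\<^sub>R 1 - X n)) \<longlonglongrightarrow> norm (norm l *\<^sub>R 1 - l)"
      by (intro tendsto_intros l)
    show "(\<lambda>n. norm (X n)) \<longlonglongrightarrow> norm l" by (intro tendsto_intros l)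
    show "\<exists>N. \<forall>n\<ge>N. norm (norm (X n) *\<^sub>R 1 - X n) \<le> norm (X n)"
      using cpos_norm_le[OF X] by blast
  qed
  ultimately show "l \<in> {h. cpos h}" unfolding cpos_def by (auto intro: exI[of _ "norm l"])
qed

lemma norm_le_one_of_cpos:
  assumes "cpos u" "cpos (1 - u)"
  shows "norm u \<le> 1"
proof -
  obtain x where x: "cpos x" "x * x = u" "\<And>S. jordan_closed S \<Longrightarrow> u \<in> S \<Longrightarrow> x \<in> S"
    using cpos_sqrt[OF assms(1)] by blast
  obtain y where y: "cpos y" "y * y = 1 - u" "\<And>S. jordan_closed S \<Longrightarrow> 1 - u \<in> S \<Longrightarrow> y \<in> S"
    using cpos_sqrt[OF assms(2)] by blast
  have "u * x = x * u" using x(2) by (metis mult.assoc)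
  then have yx: "y * x = x * y" using y(3)[OF jordan_closed_commutant[of x]] by (simp add: algebra_simps)
  have "norm x \<le> 1"
    by (rule norm_le_one_of_squares[OF cpos_star[OF x(1)] cpos_star[OF y(1)] yx[symmetric]])
      (simp add: x y)
  then show ?thesis
    using norm_selfadjoint_square[OF cpos_star[OF x(1)]] x(2) by (simp add: power_le_one)
qed

text \<open>For every \<open>\<epsilon> > 0\<close> both \<open>h/\<epsilon>\<close> and \<open>1 - h/\<epsilon>\<close> are positive, whence \<open>\<parallel>h\<parallel> \<le> \<epsilon>\<close>.\<close>
lemma cpos_antisym:
  assumes h: "cpos h" and mh: "cpos (- h)"
  shows "h = 0"
proof -
  have "norm h \<le> e" if e: "e > 0" for e
  proof -
    have "norm ((1/e) *\<^sub>R h) \<le> 1"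
    proof (rule norm_le_one_of_cpos)
      show "cpos ((1/e) *\<^sub>R h)" using h e by (intro cpos_scaleR) auto
      have "cpos (1 + (1/e) *\<^sub>R (- h))" using mh e by (intro cpos_add cpos_one cpos_scaleR) auto
      then show "cpos (1 - (1/e) *\<^sub>R h)" by simp
    qed
    then show ?thesis using e by (simp add: divide_le_eq)
  qed
  then have "norm h \<le> 0" by (rule field_le_epsilon[of _ 0, simplified])
  then show ?thesis by simp
qed

section \<open>Positivity of \<open>b\<^sup>*b\<close>\<close>

lemma norm_selfadjoint_power:
  fixes k :: "'a::{cstar_algebra,real_normed_algebra_1}"
  assumes "star k = k"
  shows "norm (k ^ (2 ^ m)) = norm k ^ (2 ^ m)"
proof (induction m)
  case (Suc m)
  have "star (k ^ n) = k ^ n" for n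
    by (induction n) (simp_all add: star_mult assms power_commutes)
  then have "norm (k ^ (2 ^ m) * k ^ (2 ^ m)) = (norm (k ^ (2 ^ m)))\<^sup>2"
    by (rule norm_selfadjoint_square)
  then show ?case
    by (simp add: Suc power2_eq_square mult_2 power_add)
qed simp

text \<open>If \<open>x = 1 + d\<close> with \<open>d > 0\<close>, Bernoulli's inequality gives \<open>x\<^sup>2\<^sup>n \<ge> (nd)\<^sup>2\<close>, which outgrows every linear
  bound; \<open>n\<close> runs through the powers of two.\<close>
lemma le_one_of_power_growth:
  fixes x C :: real
  assumes C: "0 \<le> C" and growth: "\<And>m. x ^ (2 ^ m) \<le> 1 + 2 ^ m * C"
  shows "x \<le> 1"
proof (rule ccontr)
  assume "\<not> x \<le> 1"
  define d where "d = x - 1"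
  have d: "d > 0" using \<open>\<not> x \<le> 1\<close> by (simp add: d_def)
  have bound: "2 ^ m * d\<^sup>2 \<le> 1 + 2 * C" for m :: nat
  proof -
    define n :: real where "n = 2 ^ m"
    have n: "1 \<le> n" by (simp add: n_def)
    have "n * d \<le> x ^ (2 ^ m)"
      using Bernoulli_inequality[of d "2 ^ m"] d by (simp add: n_def d_def)
    then have "(n * d)\<^sup>2 \<le> (x ^ (2 ^ m))\<^sup>2" using n d by (intro power_mono) auto
    also have "\<dots> = x ^ (2 ^ Suc m)" by (simp add: power_mult[symmetric] mult.commute)
    also have "\<dots> \<le> 1 + 2 ^ Suc m * C" by (rule growth)
    also have "\<dots> \<le> n * 1 + n * (2 * C)" using n by (simp add: n_def)
    finally have "n * (n * d\<^sup>2) \<le> n * (1 + 2 * C)" by (simp add: power2_eq_square algebra_simps)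
    then show ?thesis using n by (simp add: n_def)
  qed
  obtain m where m: "(1 + 2 * C) / d\<^sup>2 < real m" using reals_Archimedean2 by blast
  have "real m < 2 ^ m" using of_nat_less_two_power by blast
  with m have "(1 + 2 * C) / d\<^sup>2 < 2 ^ m" by linarith
  then have "1 + 2 * C < 2 ^ m * d\<^sup>2" using d by (simp add: divide_less_eq)
  with bound[of m] show False by linarith
qed

text \<open>The usual argument compares the spectra of \<open>c\<^sup>*c\<close> and \<open>cc\<^sup>*\<close>.  Here only norms of powers are compared.
  After scaling, \<open>T = 1 + b\<^sup>*b\<close> is a contraction.  Put \<open>K = 1 + bb\<^sup>*\<close>.  Then \<open>K\<^sup>nb = bT\<^sup>n\<close>, so
  \<open>K\<^sup>n\<^sup>+\<^sup>1 = K\<^sup>n + bT\<^sup>nb\<^sup>*\<close>, and \<open>\<parallel>K\<^sup>n\<parallel>\<close> grows at most linearly in \<open>n\<close>.  Since \<open>K\<close> is self-adjoint, its norm is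
  multiplicative along the powers \<open>2\<^sup>m\<close>, and linear growth forces \<open>\<parallel>K\<parallel> \<le> 1\<close>.\<close>
lemma cpos_neg_swap:
  fixes c :: "'a::{cstar_algebra,real_normed_algebra_1}"
  assumes neg: "cpos (- (star c * c))"
  shows "cpos (- (c * star c))"
proof -
  \<comment> \<open>Adding 1 keeps \<open>t\<close> positive when \<open>c = 0\<close>.\<close>
  define t where "t = norm (star c * c) + 1"
  have t: "t > 0" by (simp add: t_def add_nonneg_pos)
  define b where "b = (1 / sqrt t) *\<^sub>R c"
  define T where "T = 1 + star b * b"
  define K where "K = 1 + b * star b"
  have "star b * b = (1 / t) *\<^sub>R (star c * c)" using t by (simp add: b_def star_scaleR)
  moreover have "norm (t *\<^sub>R 1 - - (star c * c)) \<le> t"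
    by (rule cpos_norm_le[OF neg]) (simp add: t_def)
  moreover have "T = (1 / t) *\<^sub>R (t *\<^sub>R 1 + star c * c)"
    using t calculation(1) by (simp add: T_def scaleR_right_distrib)
  ultimately have T: "norm T \<le> 1" using t by simp
  have Kb: "K * b = b * T" by (simp add: K_def T_def algebra_simps)
  have KT: "K ^ n * b = b * T ^ n" for n
  proof (induction n)
    case (Suc n)
    have "K ^ Suc n * b = K ^ n * (K * b)" by (simp only: power_Suc2 mult.assoc)
    also have "\<dots> = b * T ^ n * T" by (simp only: Kb Suc flip: mult.assoc)
    finally show ?case by (simp only: power_Suc2 mult.assoc)
  qed simp
  have "norm (K ^ n) \<le> 1 + real n * (norm b)\<^sup>2" for n
  proof (induction n)
    case (Suc n)
    have "K ^ Suc n = K ^ n * K" by (rule power_Suc2)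
    also have "\<dots> = K ^ n + K ^ n * b * star b" by (simp add: K_def distrib_left mult.assoc)
    also have "\<dots> = K ^ n + b * T ^ n * star b" by (simp only: KT)
    finally have "norm (K ^ Suc n) \<le> norm (K ^ n) + norm (b * T ^ n * star b)"
      by (simp only: norm_triangle_ineq)
    also have "norm (b * T ^ n * star b) \<le> norm b * 1 * norm b"
    proof -
      have "norm (T ^ n) \<le> 1"
        using norm_power_ineq[of T n] power_le_one[OF norm_ge_zero T, of n] by linarith
      then have "norm (b * T ^ n) \<le> norm b * 1"
        by (intro order_trans[OF norm_mult_ineq] mult_left_mono) auto
      then show ?thesis
        by (intro order_trans[OF norm_mult_ineq]) (simp add: mult_right_mono)
    qed
    finally show ?case using Suc by (simp add: algebra_simps power2_eq_square)
  qed simp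
  moreover have sK: "star K = K" by (simp add: K_def star_add star_mult star_star)
  ultimately have "norm K ^ (2 ^ m) \<le> 1 + 2 ^ m * (norm b)\<^sup>2" for m
    by (metis norm_selfadjoint_power of_nat_numeral of_nat_power)
  then have "norm K \<le> 1" by (intro le_one_of_power_growth[of "(norm b)\<^sup>2"]) auto
  then have "cpos (- (b * star b))"
    by (intro cposI) (simp_all add: K_def star_minus star_mult star_star)
  moreover have "- (b * star b) = (1 / t) *\<^sub>R (- (c * star c))"
    using t by (simp add: b_def star_scaleR)
  ultimately show ?thesis using t by (simp add: cpos_scaleR_iff del: scaleR_minus_right)
qed

text \<open>If \<open>c = u + iv\<close> with \<open>u\<close>, \<open>v\<close> self-adjoint, the sum equals \<open>2(u\<^sup>2 + v\<^sup>2)\<close>; below \<open>x = 2u\<close> and \<open>y = -2v\<close>.\<close>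
lemma cpos_star_mult_add:
  fixes c :: "'a::{cstar_algebra,real_normed_algebra_1}"
  shows "cpos (star c * c + c * star c)"
proof -
  define x where "x = c + star c"
  define y where "y = \<i> *\<^sub>C (c - star c)"
  have x: "star x = x" by (simp add: x_def star_add star_star add.commute)
  have y: "star y = y"
    by (simp add: y_def star_scaleC star_diff star_star scaleC_minus_left scaleC_diff_right)
  have "x * x + y * y = 2 *\<^sub>R (star c * c + c * star c)"
    by (simp add: x_def y_def algebra_simps scaleC_mult_left scaleC_mult_right scaleC_scaleC
        scaleC_minus_left scaleC_diff_right scaleR_2)
  moreover have "cpos (x * x + y * y)" by (intro cpos_add cpos_square x y)
  ultimately show ?thesis by (simp add: cpos_scaleR_iff)
qed

lemma square_eq_zero: "star x = x \<Longrightarrow> x * x = 0 \<Longrightarrow> x = (0::'a::cstar_algebra)"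
  using norm_selfadjoint_square[of x] by simp

text \<open>Let \<open>a = b\<^sup>*b\<close>, let \<open>h = |a|\<close> be the root of \<open>a\<^sup>2\<close>, and let \<open>d = |a| - a\<close> be twice the negative part of \<open>a\<close>.  The
  element \<open>c = bd\<close> satisfies \<open>c\<^sup>*c = dad = -d|a|d\<close>, which is minus a square.  Then \<open>-cc\<^sup>*\<close> is positive too, and
  adding it to the positive element \<open>c\<^sup>*c + cc\<^sup>*\<close> shows that \<open>c\<^sup>*c\<close> is also positive.  Hence \<open>c\<^sup>*c = 0\<close>, which
  collapses to \<open>d = 0\<close>.\<close>
lemma cpos_star_mult:
  fixes b :: "'a::{cstar_algebra,real_normed_algebra_1}"
  shows "cpos (star b * b)"
proof -
  define a where "a = star b * b"
  have a: "star a = a" by (simp add: a_def star_mult star_star)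
  obtain h where h: "cpos h" "h * h = a * a" "\<And>S. jordan_closed S \<Longrightarrow> a * a \<in> S \<Longrightarrow> h \<in> S"
    using cpos_sqrt[OF cpos_square[OF a]] by blast
  have ha: "h * a = a * h" using h(3)[OF jordan_closed_commutant[of a]] by (simp add: mult.assoc)
  obtain r where r: "cpos r" "r * r = h" "\<And>S. jordan_closed S \<Longrightarrow> h \<in> S \<Longrightarrow> r \<in> S"
    using cpos_sqrt[OF h(1)] by blast
  define d where "d = h - a"
  have d: "star d = d" by (simp add: d_def star_diff a cpos_star h)
  have "h * d = d * h" by (simp add: d_def algebra_simps ha)
  then have rd: "r * d = d * r" using r(3)[OF jordan_closed_commutant[of d]] by simp
  have ad: "a * d = - (h * d)" by (simp add: d_def algebra_simps ha h)
  define c where "c = b * d"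
  have srd: "star (r * d) = r * d" by (simp add: star_mult d cpos_star r rd)
  have "star c * c = d * (a * d)"
    by (simp add: c_def star_mult d a_def mult.assoc)
  also have "\<dots> = - (d * r * (r * d))" by (simp only: ad r(2)[symmetric] mult.assoc mult_minus_right)
  finally have cc: "star c * c = - (r * d * (r * d))" by (simp only: rd)
  then have neg: "cpos (- (star c * c))" using cpos_square[OF srd] by simp
  have "cpos (star c * c)"
    using cpos_add[OF cpos_star_mult_add[of c] cpos_neg_swap[OF neg]] by simp
  with neg have "star c * c = 0" by (rule cpos_antisym[rotated])
  then have "r * d = 0" using cc square_eq_zero[OF srd] by simp
  then have "h * d = 0" by (metis mult.assoc mult_zero_right r(2))
  then have "d * d = 0" using ad by (simp add: d_def left_diff_distrib)
  then have "d = 0" by (rule square_eq_zero[OF d])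
  then show ?thesis using h(1) by (simp add: d_def a_def)
qed

text \<open>Here \<open>h\<close> plays the role of \<open>|a|\<close>.  The element \<open>d = h - a\<close> satisfies \<open>d\<^sup>2 = 2hd\<close>, and it is shown to equal
  \<open>k = |d|\<close>.  Put \<open>e = k - d\<close>.  All these elements commute, \<open>e\<^sup>2 = 2ke\<close>, and \<open>(k + 2h)e\<^sup>2 = 0\<close>.  Both \<open>ke\<^sup>2\<close> and \<open>2he\<^sup>2\<close>
  are positive, so they vanish, and then \<open>ke\<close>, \<open>e\<^sup>2\<close> and \<open>e\<close> vanish in turn.\<close>
lemma cpos_abs_diff:
  assumes a: "star a = a" and h: "cpos h" and hh: "h * h = a * a" and ha: "h * a = a * h"
  shows "cpos (h - a)"
proof -
  define d where "d = h - a"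
  have d: "star d = d" by (simp add: d_def star_diff a cpos_star h)
  have hd: "h * d = d * h" by (simp add: d_def algebra_simps ha)
  have dd: "d * d = 2 *\<^sub>R (h * d)" by (simp add: d_def algebra_simps ha hh scaleR_2)
  obtain k where k: "cpos k" "k * k = d * d" "\<And>S. jordan_closed S \<Longrightarrow> d * d \<in> S \<Longrightarrow> k \<in> S"
    using cpos_sqrt[OF cpos_square[OF d]] by blast
  have kd: "k * d = d * k" using k(3)[OF jordan_closed_commutant[of d]] by (simp add: mult.assoc)
  have "d * d * h = h * (d * d)" by (metis hd mult.assoc)
  then have kh: "k * h = h * k" using k(3)[OF jordan_closed_commutant[of h]] by simp
  define e where "e = k - d"
  have e: "star e = e" by (simp add: e_def star_diff d cpos_star k)
  have ke: "k * e = e * k" and he: "h * e = e * h" by (simp_all add: e_def algebra_simps kd kh hd)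
  obtain s where s: "cpos s" "s * s = k" "\<And>S. jordan_closed S \<Longrightarrow> k \<in> S \<Longrightarrow> s \<in> S"
    using cpos_sqrt[OF k(1)] by blast
  obtain g where g: "cpos g" "g * g = h" "\<And>S. jordan_closed S \<Longrightarrow> h \<in> S \<Longrightarrow> g \<in> S"
    using cpos_sqrt[OF h] by blast
  have se: "s * e = e * s" using s(3)[OF jordan_closed_commutant[of e]] ke by simp
  have ge: "g * e = e * g" using g(3)[OF jordan_closed_commutant[of e]] he by simp
  have sse: "star (s * e) = s * e" "star (g * e) = g * e"
    by (simp_all add: star_mult e cpos_star s g se ge)
  have ee: "e * e = 2 *\<^sub>R (k * e)" by (simp add: e_def algebra_simps kd k scaleR_2)
  have hd2: "2 *\<^sub>R (h * d) = k * k" by (simp only: dd k)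
  have "2 *\<^sub>R (h * (k * k)) = 2 *\<^sub>R (h * d) * d" by (simp add: k mult.assoc)
  then have 1: "2 *\<^sub>R (h * (k * k)) = k * (k * d)" by (simp only: hd2 mult.assoc)
  have "h * (k * d) = k * (h * d)" by (metis kh mult.assoc)
  then have "2 *\<^sub>R (h * (k * d)) = k * (2 *\<^sub>R (h * d))" by simp
  then have 2: "2 *\<^sub>R (h * (k * d)) = k * (k * k)" by (simp only: hd2)
  have "2 *\<^sub>R (h * (k * e)) = - (k * (k * e))"
    using 1 2 by (simp add: e_def right_diff_distrib scaleR_right_diff_distrib)
  then have key: "2 *\<^sub>R (h * (e * e)) = - (k * (e * e))" by (simp add: ee)
  have g2: "g * e * (g * e) = h * (e * e)" by (metis g(2) ge mult.assoc)
  have s2: "s * e * (s * e) = k * (e * e)" by (metis s(2) se mult.assoc)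
  have "cpos (k * (e * e))" using cpos_square[OF sse(1)] s2 by simp
  moreover have "cpos (- (k * (e * e)))"
    using cpos_scaleR[OF cpos_square[OF sse(2)], of 2] g2 key by simp
  ultimately have "k * (e * e) = 0" by (rule cpos_antisym)
  then have "s * e = 0" using square_eq_zero[OF sse(1)] s2 by simp
  then have "k * e = 0" by (metis mult.assoc mult_zero_right s(2))
  then have "e * e = 0" by (simp add: ee)
  then have "e = 0" by (rule square_eq_zero[OF e])
  then show ?thesis using k(1) by (simp add: e_def d_def)
qed

section \<open>Positive elements of a general \<open>C\<^sup>*\<close>-algebra\<close>

definition pos_elem :: "'a::cstar_algebra \<Rightarrow> bool" where
  "pos_elem a \<longleftrightarrow> (\<exists>b. a = star b * b)"

text \<open>The set is \<open>M + \<complex>1\<close> inside the unitization.\<close>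
lemma jordan_closed_unitize:
  assumes M: "cstar_subalgebra M"
  shows "jordan_closed {x. alg_part x \<in> M}"
proof -
  have sc: "c *\<^sub>C a \<in> M" if "a \<in> M" for c a
    using M that by (auto simp: cstar_subalgebra_def csubspace_def)
  have "closed (alg_part -` M)"
    using M by (intro closed_vimage) (auto simp: cstar_subalgebra_def bounded_linear_alg_part
        intro: linear_continuous_on)
  moreover have "r *\<^sub>R a \<in> M" if "a \<in> M" for r a
    using sc[OF that, of "complex_of_real r"] by (simp add: scaleC_of_real)
  ultimately show ?thesis
    using M sc unfolding jordan_closed_def
    by (auto simp: cstar_subalgebra_def csubspace_def vimage_def)
qed

text \<open>The root in the unitization lies in \<open>M + \<complex>1\<close>.  The character \<open>scalar_part\<close> sends its square to zero,
  hence sends it to zero as well, so the root lies in \<open>M\<close> itself.\<close>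
lemma cpos_embed_sqrt:
  assumes M: "cstar_subalgebra M" and a: "a \<in> M" and pos: "cpos (embed a)"
  obtains r where "r \<in> M" "star r = r" "r * r = a" "cpos (embed r)"
proof -
  obtain x where x: "cpos x" "x * x = embed a" "\<And>S. jordan_closed S \<Longrightarrow> embed a \<in> S \<Longrightarrow> x \<in> S"
    using cpos_sqrt[OF pos] by blast
  have xM: "alg_part x \<in> M" using x(3)[OF jordan_closed_unitize[OF M]] a by simp
  have "scalar_part (x * x) = 0" by (simp only: x(2) embed_sel)
  then have "scalar_part x = 0" by simp
  then have ex: "embed (alg_part x) = x" by (rule embed_alg_part)
  show ?thesis
  proof (rule that[OF xM])
    show "star (alg_part x) = alg_part x"
      by (metis cpos_star embed_sel(1) embed_star ex x(1))
    show "alg_part x * alg_part x = a"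
      by (metis embed_mult embed_sel(1) ex x(2))
    show "cpos (embed (alg_part x))" using ex x(1) by simp
  qed
qed

lemma cstar_subalgebra_UNIV: "cstar_subalgebra UNIV"
  by (simp add: cstar_subalgebra_def csubspace_def)

lemma pos_elem_iff: "pos_elem a \<longleftrightarrow> cpos (embed a)"
proof
  assume "pos_elem a"
  then show "cpos (embed a)"
    unfolding pos_elem_def by (metis cpos_star_mult embed_mult embed_star)
next
  assume "cpos (embed a)"
  then show "pos_elem a"
    unfolding pos_elem_def by (metis cpos_embed_sqrt[OF cstar_subalgebra_UNIV UNIV_I])
qed

text \<open>A witness \<open>b\<close> of positivity taken from the ambient algebra can be replaced by one from any
  \<open>C\<^sup>*\<close>-subalgebra that contains \<open>a\<close>.\<close>
lemma pos_elem_sqrt: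
  assumes "cstar_subalgebra M" "a \<in> M" "pos_elem a"
  shows "\<exists>r\<in>M. a = star r * r"
  using cpos_embed_sqrt[OF assms(1,2)] assms(3) unfolding pos_elem_iff by metis

text \<open>The decomposition used is \<open>a = |a| - (|a| - a)\<close> with \<open>\<parallel>|a|\<parallel> = \<parallel>a\<parallel>\<close>.\<close>
lemma selfadjoint_decomposition:
  fixes a :: "'a::cstar_algebra"
  assumes a: "star a = a"
  obtains p q where "pos_elem p" "pos_elem q" "a = p - q" "norm p \<le> norm a" "norm q \<le> 2 * norm a"
proof -
  have ea: "star (embed a) = embed a" using a by (simp flip: embed_star)
  obtain h where h: "cpos h" "h * h = embed a * embed a"
    "\<And>S. jordan_closed S \<Longrightarrow> embed a * embed a \<in> S \<Longrightarrow> h \<in> S"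
    using cpos_sqrt[OF cpos_square[OF ea]] by blast
  have ha: "h * embed a = embed a * h"
    using h(3)[OF jordan_closed_commutant[of "embed a"]] by (simp add: mult.assoc)
  define p where "p = alg_part h"
  have "scalar_part (h * h) = 0" by (simp add: h(2))
  then have "scalar_part h = 0" by simp
  then have ep: "embed p = h" unfolding p_def by (rule embed_alg_part)
  have "(norm h)\<^sup>2 = (norm (embed a))\<^sup>2"
    using norm_selfadjoint_square[OF cpos_star[OF h(1)]] norm_selfadjoint_square[OF ea] h(2) by simp
  then have np: "norm p = norm a" by (simp flip: ep)
  show ?thesis
  proof (rule that[of p "p - a"])
    show "pos_elem p" by (simp add: pos_elem_iff ep h)
    show "pos_elem (p - a)"
      using cpos_abs_diff[OF ea h(1,2) ha] by (simp add: pos_elem_iff embed_diff ep)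
    show "norm (p - a) \<le> 2 * norm a" using norm_triangle_ineq4[of p a] np by simp
  qed (simp_all add: np)
qed

lemma pos_elem_add: "pos_elem a \<Longrightarrow> pos_elem b \<Longrightarrow> pos_elem (a + b)"
  by (simp add: pos_elem_iff embed_add cpos_add)

lemma pos_elem_scaleR: "pos_elem a \<Longrightarrow> 0 \<le> r \<Longrightarrow> pos_elem (r *\<^sub>R a)"
  by (simp add: pos_elem_iff embed_scaleR cpos_scaleR)

lemma pos_elem_sum: "(\<And>i. i \<in> I \<Longrightarrow> pos_elem (f i)) \<Longrightarrow> pos_elem (sum f I)"
proof (induction I rule: infinite_finite_induct)
  case (insert i I)
  then show ?case by (simp add: pos_elem_add)
qed (auto simp: pos_elem_def intro: exI[of _ 0])

lemma closed_pos_elem: "closed {a. pos_elem a}"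
proof -
  have "bounded_linear (embed :: 'a \<Rightarrow> 'a unitization)"
    by (rule bounded_linear_intro[where K = 1]) (simp_all add: embed_add embed_scaleR)
  then have "closed (embed -` {h :: 'a unitization. cpos h})"
    by (intro closed_vimage closed_cpos linear_continuous_on)
  then show ?thesis by (simp add: pos_elem_iff vimage_def)
qed

text \<open>Take \<open>a = \<Sum>\<^sub>k 2\<^sup>-\<^sup>kp\<^sub>k\<close>; removing one summand leaves a limit of positive elements.\<close>
lemma ex_pos_elem_dominating:
  fixes p :: "nat \<Rightarrow> 'a::cstar_algebra"
  assumes pos: "\<And>n. pos_elem (p n)" and bdd: "\<And>n. norm (p n) \<le> 1"
  shows "\<exists>a. \<forall>n. pos_elem (a - (1/2) ^ n *\<^sub>R p n)"
proof -
  define f where "f n = (1/2) ^ n *\<^sub>R p n" for n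
  have "summable (\<lambda>n. (1/2) ^ n :: real)" by (rule summable_geometric) simp
  moreover have "norm (f n) \<le> (1/2) ^ n" for n
    using mult_left_mono[OF bdd[of n], of "(1/2) ^ n"] by (simp add: f_def)
  ultimately have sm: "summable f" by (rule summable_comparison_test')
  have "pos_elem (suminf f - f n)" for n
  proof -
    have "(\<lambda>N. (\<Sum>k<N. f k) - f n) \<longlonglongrightarrow> suminf f - f n"
      by (intro tendsto_intros summable_LIMSEQ sm)
    moreover have "pos_elem ((\<Sum>k<N. f k) - f n)" if "N \<ge> Suc n" for N
    proof -
      have "(\<Sum>k<N. f k) - f n = (\<Sum>k\<in>{..<N} - {n}. f k)"
        using that by (simp add: sum_diff1)
      moreover have "pos_elem (\<Sum>k\<in>{..<N} - {n}. f k)"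
        by (intro pos_elem_sum) (simp add: f_def pos_elem_scaleR pos)
      ultimately show ?thesis by simp
    qed
    ultimately have "suminf f - f n \<in> {a. pos_elem a}"
      by (intro Lim_in_closed_set[OF closed_pos_elem, of _ sequentially])
        (auto simp: eventually_sequentially)
    then show ?thesis by simp
  qed
  then show ?thesis unfolding f_def by blast
qed

section \<open>Adjoints of bounded operators\<close>

lemma blinfun_compose_assoc: "(R o\<^sub>L S) o\<^sub>L T = R o\<^sub>L (S o\<^sub>L T)"
  by (rule blinfun_eqI) simp

lemma cblin_adj: "T \<in> cblin \<Longrightarrow> adj T \<in> cblin"
  using is_adjoint_adj by (auto simp: is_adjoint_def)

lemma cinner_adj: "T \<in> cblin \<Longrightarrow> cinner (blinfun_apply T x) y = cinner x (blinfun_apply (adj T) y)"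
  using is_adjoint_adj by (auto simp: is_adjoint_def)

lemma cinner_adj2: "T \<in> cblin \<Longrightarrow> cinner (blinfun_apply (adj T) x) y = cinner x (blinfun_apply T y)"
  by (metis cinner_adj cinner_commute)

lemma adjI: "S \<in> cblin \<Longrightarrow> (\<And>x y. cinner (blinfun_apply T x) y = cinner x (blinfun_apply S y)) \<Longrightarrow> adj T = S"
  unfolding adj_def by (rule the_equality) (auto simp: is_adjoint_def intro!: is_adjoint_unique)

lemma cblin_compose: "S \<in> cblin \<Longrightarrow> T \<in> cblin \<Longrightarrow> S o\<^sub>L T \<in> cblin"
  by (simp add: cblin_def)

lemma cblin_add: "S \<in> cblin \<Longrightarrow> T \<in> cblin \<Longrightarrow> S + T \<in> cblin"
  by (simp add: cblin_def blinfun.add_left scaleC_add_right)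

lemma cblin_scaleC: "T \<in> cblin \<Longrightarrow> c *\<^sub>C T \<in> cblin"
  by (simp add: cblin_def blinfun_apply_scaleC scaleC_scaleC mult.commute)

lemma adj_compose: "S \<in> cblin \<Longrightarrow> T \<in> cblin \<Longrightarrow> adj (S o\<^sub>L T) = adj T o\<^sub>L adj S"
  by (rule adjI) (simp_all add: cblin_adj cblin_compose cinner_adj)

lemma adj_add: "S \<in> cblin \<Longrightarrow> T \<in> cblin \<Longrightarrow> adj (S + T) = adj S + adj T"
  by (rule adjI)
    (simp_all add: cblin_adj cblin_add cinner_adj blinfun.add_left cinner_add_left cinner_add_right)

lemma adj_scaleC: "T \<in> cblin \<Longrightarrow> adj (c *\<^sub>C T) = cnj c *\<^sub>C adj T"
  by (rule adjI)
    (simp_all add: cblin_adj cblin_scaleC cinner_adj blinfun_apply_scaleC cinner_scaleC_left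
      cinner_scaleC_right)

lemma adj_adj: "T \<in> cblin \<Longrightarrow> adj (adj T) = T"
  by (rule adjI) (simp_all add: cinner_adj2)

lemma norm_adj_le:
  assumes T: "T \<in> cblin"
  shows "norm (adj T) \<le> norm T"
proof (rule norm_blinfun_bound)
  fix y
  show "norm (adj T y) \<le> norm T * norm y"
  proof (cases "adj T y = 0")
    case False
    have "(norm (adj T y))\<^sup>2 = cmod (cinner (adj T y) (adj T y))"
      by (simp add: cinner_self norm_power)
    also have "\<dots> = cmod (cinner (T (adj T y)) y)" by (simp add: cinner_adj T)
    also have "\<dots> \<le> norm (T (adj T y)) * norm y" by (rule cauchy_schwarz)
    also have "\<dots> \<le> norm T * norm (adj T y) * norm y"
      by (intro mult_right_mono norm_blinfun) auto
    finally show ?thesis using False by (simp add: power2_eq_square mult_ac)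
  qed simp
qed simp

lemma norm_square_le_of_adj_compose:
  assumes T: "T \<in> cblin"
  shows "(norm T)\<^sup>2 \<le> norm (adj T o\<^sub>L T)"
proof -
  have "norm T \<le> sqrt (norm (adj T o\<^sub>L T))"
  proof (rule norm_blinfun_bound)
    fix h
    have "(norm (T h))\<^sup>2 = cmod (cinner (T h) (T h))" by (simp add: cinner_self norm_power)
    also have "\<dots> = cmod (cinner h ((adj T o\<^sub>L T) h))" by (simp add: cinner_adj T)
    also have "\<dots> \<le> norm h * norm ((adj T o\<^sub>L T) h)" by (rule cauchy_schwarz)
    also have "\<dots> \<le> norm h * (norm (adj T o\<^sub>L T) * norm h)"
      by (intro mult_left_mono norm_blinfun) auto
    also have "\<dots> = (sqrt (norm (adj T o\<^sub>L T)) * norm h)\<^sup>2"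
      by (simp add: power2_eq_square)
    finally show "norm (T h) \<le> sqrt (norm (adj T o\<^sub>L T)) * norm h"
      by (rule power2_le_imp_le) simp
  qed simp
  then show ?thesis by (rule sqrt_ge_absD[OF order_trans[OF eq_refl[OF abs_of_nonneg]], rotated]) simp
qed

text \<open>The identity \<open>\<langle>h, Rh\<rangle> = \<parallel>Sh\<parallel>\<^sup>2 + \<parallel>Th\<parallel>\<^sup>2\<close> gives \<open>\<parallel>T\<parallel>\<^sup>2 \<le> \<parallel>R\<parallel>\<close>.\<close>
lemma norm_adj_compose_mono:
  fixes R S T :: "'h::chilbert_space \<Rightarrow>\<^sub>L 'h"
  assumes S: "S \<in> cblin" and T: "T \<in> cblin" and R: "R = (adj S o\<^sub>L S) + (adj T o\<^sub>L T)"
  shows "norm (adj T o\<^sub>L T) \<le> norm R"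
proof -
  have "norm T \<le> sqrt (norm R)"
  proof (rule norm_blinfun_bound)
    fix h
    have "cinner h (R h) = cinner (S h) (S h) + cinner (T h) (T h)"
      by (simp add: R blinfun.add_left cinner_add_right cinner_adj S T)
    then have "Re (cinner h (R h)) = (norm (S h))\<^sup>2 + (norm (T h))\<^sup>2"
      by (simp add: Re_cinner_self)
    then have "(norm (T h))\<^sup>2 \<le> cmod (cinner h (R h))"
      using complex_Re_le_cmod[of "cinner h (R h)"] zero_le_power2[of "norm (S h)"] by linarith
    also have "\<dots> \<le> norm h * norm (R h)" by (rule cauchy_schwarz)
    also have "\<dots> \<le> norm h * (norm R * norm h)" by (intro mult_left_mono norm_blinfun) auto
    also have "\<dots> = (sqrt (norm R) * norm h)\<^sup>2" by (simp add: power2_eq_square)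
    finally show "norm (T h) \<le> sqrt (norm R) * norm h" by (rule power2_le_imp_le) simp
  qed simp
  then have "norm (adj T) * norm T \<le> sqrt (norm R) * sqrt (norm R)"
    using norm_adj_le[OF T] by (intro mult_mono) auto
  then show ?thesis using norm_blinfun_compose[of "adj T" T] by simp
qed

section \<open>Positive linear maps\<close>

text \<open>The last condition is the case of \<open>1 \<times> 1\<close> matrices in the definition of complete positivity.\<close>
locale positive_linear_map =
  fixes \<phi> :: "'a::cstar_algebra \<Rightarrow> ('h::chilbert_space \<Rightarrow>\<^sub>L 'h)"
  assumes cblin: "\<phi> a \<in> cblin"
    and add: "\<phi> (a + b) = \<phi> a + \<phi> b"
    and scaleC: "\<phi> (c *\<^sub>C a) = c *\<^sub>C \<phi> a"
    and pos: "\<exists>T\<in>cblin. \<phi> (star b * b) = adj T o\<^sub>L (T :: 'h \<Rightarrow>\<^sub>L 'h)"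
begin

lemma scaleR: "\<phi> (r *\<^sub>R a) = r *\<^sub>R \<phi> a"
  using scaleC[of "complex_of_real r" a] by (simp only: scaleC_of_real)

lemma zero: "\<phi> 0 = 0"
  using scaleR[of 0 0] by simp

lemma diff: "\<phi> (a - b) = \<phi> a - \<phi> b"
  using add[of "a - b" b] by simp

lemma pos_elem: "pos_elem p \<Longrightarrow> \<exists>T\<in>cblin. \<phi> p = adj T o\<^sub>L (T :: 'h \<Rightarrow>\<^sub>L 'h)"
  using pos unfolding pos_elem_def by blast

lemma adj_pos_elem:
  assumes "pos_elem p"
  shows "adj (\<phi> p) = \<phi> p"
proof -
  obtain T :: "'h \<Rightarrow>\<^sub>L 'h" where T: "T \<in> cblin" "\<phi> p = adj T o\<^sub>L T" using pos_elem assms by blast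
  then show ?thesis by (simp add: adj_compose adj_adj cblin_adj)
qed

lemma adj_selfadjoint:
  assumes "star a = a"
  shows "adj (\<phi> a) = \<phi> a"
proof -
  obtain p q where pq: "pos_elem p" "pos_elem q" "a = p - q"
    using selfadjoint_decomposition[OF assms] by metis
  have "a = p + (-1) *\<^sub>C q" using pq(3) by (simp add: scaleC_minus_left)
  then have "\<phi> a = \<phi> p + (-1) *\<^sub>C \<phi> q" by (simp only: add scaleC)
  then show ?thesis
    by (simp add: adj_add adj_scaleC cblin cblin_scaleC adj_pos_elem pq)
qed

end

lemma cartesian_decomposition:
  fixes a :: "'a::cstar_algebra"
  obtains x y where "star x = x" "star y = y" "a = x + \<i> *\<^sub>C y" "norm x \<le> norm a" "norm y \<le> norm a"
proof -
  define x where "x = (1/2) *\<^sub>R (a + star a)"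
  define y where "y = (- \<i> / 2) *\<^sub>C (a - star a)"
  have "\<i> *\<^sub>C y = (complex_of_real (1/2)) *\<^sub>C (a - star a)"
    by (simp add: y_def scaleC_scaleC)
  then have "a = x + \<i> *\<^sub>C y"
    by (simp only: scaleC_of_real x_def) (simp add: algebra_simps flip: scaleR_left_distrib)
  moreover have "star x = x" by (simp add: x_def star_scaleR star_add star_star add.commute)
  moreover have "star y = y"
    by (simp add: y_def star_scaleC star_diff star_star scaleC_diff_right scaleC_minus_left)
  moreover have "norm x \<le> norm a" using norm_triangle_ineq[of a "star a"] by (simp add: x_def)
  moreover have "norm y \<le> norm a"
    using norm_triangle_ineq4[of a "star a"] by (simp add: y_def norm_scaleC norm_divide)
  ultimately show ?thesis using that by blast
qed

context positive_linear_map
begin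

lemma adj_star: "\<phi> (star a) = adj (\<phi> a)"
proof -
  obtain x y where xy: "star x = x" "star y = y" "a = x + \<i> *\<^sub>C y"
    using cartesian_decomposition[of a] by metis
  have "adj (\<phi> a) = \<phi> x + (- \<i>) *\<^sub>C \<phi> y"
    by (simp add: xy(3) add scaleC adj_add adj_scaleC cblin cblin_scaleC adj_selfadjoint xy)
  moreover have "star a = x + (- \<i>) *\<^sub>C y"
    by (simp add: xy(3) star_add star_scaleC xy)
  ultimately show ?thesis by (simp only: add scaleC)
qed

text \<open>If \<open>\<parallel>\<phi>(p\<^sub>n)\<parallel> > 4\<^sup>n\<close> for positive contractions \<open>p\<^sub>n\<close>, an element \<open>a\<close> dominating all \<open>2\<^sup>-\<^sup>np\<^sub>n\<close> would satisfy
  \<open>\<parallel>\<phi>(a)\<parallel> > 2\<^sup>n\<close> for every \<open>n\<close>.\<close>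
lemma bounded_on_pos_elem: "\<exists>K. \<forall>p. pos_elem p \<longrightarrow> norm p \<le> 1 \<longrightarrow> norm (\<phi> p) \<le> K"
proof (rule ccontr)
  assume "\<not> ?thesis"
  then have "\<exists>p. pos_elem p \<and> norm p \<le> 1 \<and> norm (\<phi> p) > 4 ^ n" for n :: nat
    by (meson not_less)
  then obtain p where p: "\<And>n. pos_elem (p n)" "\<And>n. norm (p n) \<le> 1" "\<And>n. norm (\<phi> (p n)) > 4 ^ n"
    by metis
  obtain a where a: "\<And>n. pos_elem (a - (1/2) ^ n *\<^sub>R p n)"
    using ex_pos_elem_dominating[of p, OF p(1,2)] by blast
  have "2 ^ n < norm (\<phi> a)" for n
  proof -
    define q where "q = (1/2) ^ n *\<^sub>R p n"
    have "pos_elem q" by (simp add: q_def p pos_elem_scaleR)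
    then obtain T :: "'h \<Rightarrow>\<^sub>L 'h" where T: "T \<in> cblin" "\<phi> q = adj T o\<^sub>L T" using pos_elem by blast
    obtain S :: "'h \<Rightarrow>\<^sub>L 'h" where S: "S \<in> cblin" "\<phi> (a - q) = adj S o\<^sub>L S" using pos_elem a q_def by metis
    have "\<phi> a = (adj S o\<^sub>L S) + (adj T o\<^sub>L T)"
      using add[of "a - q" q] by (simp add: S T)
    then have "norm (\<phi> q) \<le> norm (\<phi> a)"
      using norm_adj_compose_mono[OF S(1) T(1)] T(2) by simp
    moreover have "norm (\<phi> q) = (1/2) ^ n * norm (\<phi> (p n))" by (simp add: q_def scaleR)
    moreover have "(1/2) ^ n * 4 ^ n < (1/2) ^ n * norm (\<phi> (p n))"
      using p(3)[of n] by (intro mult_strict_left_mono) auto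
    moreover have "(1/2 :: real) ^ n * 4 ^ n = 2 ^ n" by (simp flip: power_mult_distrib)
    ultimately show ?thesis by linarith
  qed
  moreover obtain n where "norm (\<phi> a) < real n" using reals_Archimedean2 by blast
  moreover have "real n < 2 ^ n" by (rule of_nat_less_two_power)
  ultimately show False by (metis less_trans order.asym)
qed

lemma bounded_linear: "bounded_linear \<phi>"
proof -
  obtain K where K: "\<And>p. pos_elem p \<Longrightarrow> norm p \<le> 1 \<Longrightarrow> norm (\<phi> p) \<le> K"
    using bounded_on_pos_elem by blast
  have K0: "0 \<le> K"
  proof -
    have "pos_elem (0 :: 'a)" unfolding pos_elem_def by (rule exI[of _ 0]) simp
    then show ?thesis using K[of 0] zero by simp
  qed
  have pos: "norm (\<phi> p) \<le> K * norm p" if p: "pos_elem p" for p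
  proof (cases "p = 0")
    case False
    have "norm (\<phi> ((1 / norm p) *\<^sub>R p)) \<le> K"
      using p False by (intro K pos_elem_scaleR) auto
    then show ?thesis using False by (simp add: scaleR field_simps)
  qed (simp add: zero)
  have sa: "norm (\<phi> a) \<le> 3 * K * norm a" if sa: "star a = a" for a
  proof -
    obtain p q where pq: "pos_elem p" "pos_elem q" "a = p - q" "norm p \<le> norm a"
      "norm q \<le> 2 * norm a"
      using selfadjoint_decomposition[OF sa] by blast
    have "norm (\<phi> a) \<le> norm (\<phi> p) + norm (\<phi> q)"
      by (simp add: pq(3) diff norm_triangle_ineq4)
    also have "norm (\<phi> p) \<le> K * norm a"
      using pos[OF pq(1)] mult_left_mono[OF pq(4) K0] by linarith
    also have "norm (\<phi> q) \<le> K * (2 * norm a)"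
      using pos[OF pq(2)] mult_left_mono[OF pq(5) K0] by linarith
    finally show ?thesis by simp
  qed
  have "norm (\<phi> a) \<le> norm a * (6 * K)" for a
  proof -
    obtain x y where xy: "star x = x" "star y = y" "a = x + \<i> *\<^sub>C y" "norm x \<le> norm a"
      "norm y \<le> norm a"
      using cartesian_decomposition[of a] by blast
    have "norm (\<i> *\<^sub>C T) \<le> norm T" for T :: "'h \<Rightarrow>\<^sub>L 'h"
      by (rule norm_blinfun_bound) (simp_all add: blinfun_apply_scaleC norm_scaleC norm_blinfun)
    then have "norm (\<phi> a) \<le> norm (\<phi> x) + norm (\<phi> y)"
      by (simp only: xy(3) add scaleC) (metis add_left_mono norm_triangle_le)
    also have "norm (\<phi> x) \<le> 3 * K * norm a"
      using sa[OF xy(1)] mult_left_mono[OF xy(4), of "3 * K"] K0 by simp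
    also have "norm (\<phi> y) \<le> 3 * K * norm a"
      using sa[OF xy(2)] mult_left_mono[OF xy(5), of "3 * K"] K0 by simp
    finally show ?thesis by (simp add: algebra_simps)
  qed
  then show ?thesis by (intro bounded_linear_intro) (auto simp: add scaleR)
qed

text \<open>Closedness comes from the continuity of \<open>\<phi>\<close>, and stability under the involution from
  \<open>\<phi>(a\<^sup>*) = \<phi>(a)\<^sup>*\<close>.\<close>
lemma multiplicative_domain_cstar_subalgebra: "cstar_subalgebra (multiplicative_domain \<phi>)"
proof -
  note [continuous_intros] = bounded_linear.continuous_on[OF bounded_linear]
    bounded_bilinear.continuous_on[OF bounded_bilinear_blinfun_compose]
  have scale: "(c *\<^sub>C S) o\<^sub>L T = c *\<^sub>C (S o\<^sub>L T)" for c and S T :: "'h \<Rightarrow>\<^sub>L 'h"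
    by (rule blinfun_eqI) (simp add: blinfun_apply_scaleC)
  have scale': "S o\<^sub>L (c *\<^sub>C T) = c *\<^sub>C (S o\<^sub>L T)" if "S \<in> cblin" for c and S T :: "'h \<Rightarrow>\<^sub>L 'h"
    using that by (intro blinfun_eqI) (simp add: blinfun_apply_scaleC cblin_def)
  have "closed (multiplicative_domain \<phi>)"
    unfolding multiplicative_domain_def
    by (intro closed_Collect_all closed_Collect_conj closed_Collect_eq continuous_intros)
  moreover have "csubspace (multiplicative_domain \<phi>)"
    by (simp add: csubspace_def multiplicative_domain_def zero add scaleC scale scale' cblin
        scaleC_mult_left scaleC_mult_right distrib_left distrib_right
        bounded_bilinear.add_left[OF bounded_bilinear_blinfun_compose]
        bounded_bilinear.add_right[OF bounded_bilinear_blinfun_compose]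
        bounded_bilinear.zero_left[OF bounded_bilinear_blinfun_compose]
        bounded_bilinear.zero_right[OF bounded_bilinear_blinfun_compose])
  moreover have "a * b \<in> multiplicative_domain \<phi>"
    if "a \<in> multiplicative_domain \<phi>" "b \<in> multiplicative_domain \<phi>" for a b
  proof -
    have a: "\<phi> (a * c) = \<phi> a o\<^sub>L \<phi> c" "\<phi> (c * a) = \<phi> c o\<^sub>L \<phi> a"
      and b: "\<phi> (b * c) = \<phi> b o\<^sub>L \<phi> c" "\<phi> (c * b) = \<phi> c o\<^sub>L \<phi> b" for c
      using that by (auto simp: multiplicative_domain_def)
    have "\<phi> (a * b * c) = \<phi> (a * b) o\<^sub>L \<phi> c" for c
      by (simp only: mult.assoc a b blinfun_compose_assoc)
    moreover have "\<phi> (c * (a * b)) = \<phi> c o\<^sub>L \<phi> (a * b)" for c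
    proof -
      have "\<phi> (c * a * b) = \<phi> c o\<^sub>L \<phi> (a * b)"
        by (simp only: b a(2) blinfun_compose_assoc)
      then show ?thesis by (simp only: mult.assoc)
    qed
    ultimately show ?thesis by (simp add: multiplicative_domain_def)
  qed
  moreover have "star a \<in> multiplicative_domain \<phi>" if "a \<in> multiplicative_domain \<phi>" for a
  proof -
    have a: "\<phi> (a * c) = \<phi> a o\<^sub>L \<phi> c" "\<phi> (c * a) = \<phi> c o\<^sub>L \<phi> a" for c
      using that by (auto simp: multiplicative_domain_def)
    have "\<phi> (star a * b) = \<phi> (star a) o\<^sub>L \<phi> b" "\<phi> (b * star a) = \<phi> b o\<^sub>L \<phi> (star a)" for b
      using adj_star[of "star b * a"] adj_star[of "a * star b"]
      by (simp_all add: star_mult star_star a adj_compose cblin cblin_adj adj_star adj_adj)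
    then show ?thesis by (simp add: multiplicative_domain_def)
  qed
  ultimately show ?thesis by (simp add: cstar_subalgebra_def)
qed

end

section \<open>The module domain\<close>

locale phi_module_map =
  hilbert_cstar_module UNIV UNIV act ip + phi: positive_linear_map \<phi>
  for act :: "'x::complex_vector \<Rightarrow> 'a::cstar_algebra \<Rightarrow> 'x"
    and ip :: "'x \<Rightarrow> 'x \<Rightarrow> 'a"
    and \<phi> :: "'a \<Rightarrow> ('h::chilbert_space \<Rightarrow>\<^sub>L 'h)" +
  fixes \<Phi> :: "'x \<Rightarrow> ('h \<Rightarrow>\<^sub>L 'k::chilbert_space)"
  assumes Phi_cblin: "\<Phi> x \<in> cblin"
    and Phi_adj: "adj (\<Phi> x) o\<^sub>L \<Phi> y = \<phi> (ip x y)"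
begin

lemmas module_simps = act_add_left[OF UNIV_I UNIV_I UNIV_I] act_add_right[OF UNIV_I UNIV_I UNIV_I]
  act_mult[OF UNIV_I UNIV_I UNIV_I] act_scaleC_left[OF UNIV_I UNIV_I]
  act_scaleC_right[OF UNIV_I UNIV_I] ip_add_right[OF UNIV_I UNIV_I UNIV_I]
  ip_scaleC_right[OF UNIV_I UNIV_I] ip_act_right[OF UNIV_I UNIV_I UNIV_I]
  ip_star[OF UNIV_I UNIV_I]

lemma ip_add_left: "ip (x + y) z = ip x z + ip y z"
  by (metis module_simps(6,9) star_add)

lemma ip_scaleC_left: "ip (c *\<^sub>C x) y = cnj c *\<^sub>C ip x y"
  by (metis module_simps(7,9) star_scaleC)

lemma ip_act_left: "ip (act x a) y = star a * ip x y"
  by (metis module_simps(8,9) star_mult)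

lemma cinner_Phi: "cinner (\<Phi> x h) (\<Phi> y h) = cinner h (\<phi> (ip x y) h)"
  by (simp add: cinner_adj Phi_cblin flip: Phi_adj)

text \<open>Linearity of \<open>\<Phi>\<close> is a consequence of the linearity of \<open>\<phi>\<close>: the squared norm of the defect \<open>v\<close> expands
  into terms \<open>\<langle>h, \<phi>(\<langle>x, y\<rangle>)h\<rangle>\<close> that cancel.\<close>
lemma Phi_add: "\<Phi> (x + y) = \<Phi> x + \<Phi> y"
proof (rule blinfun_eqI)
  fix h
  define v where "v = \<Phi> (x + y) h - \<Phi> x h - \<Phi> y h"
  have "cinner v v = 0"
    by (simp add: v_def cinner_diff_left cinner_diff_right cinner_Phi ip_add_left module_simps
        phi.add blinfun.add_left cinner_add_right)
  then have "v = 0" by (simp add: cinner_self)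
  then show "\<Phi> (x + y) h = (\<Phi> x + \<Phi> y) h" by (simp add: v_def blinfun.add_left diff_diff_eq)
qed

lemma Phi_scaleC: "\<Phi> (c *\<^sub>C x) = c *\<^sub>C \<Phi> x"
proof (rule blinfun_eqI)
  fix h
  define v where "v = \<Phi> (c *\<^sub>C x) h - c *\<^sub>C \<Phi> x h"
  have "cinner v v = 0"
    by (simp add: v_def cinner_diff_left cinner_diff_right cinner_Phi ip_scaleC_left module_simps
        phi.scaleC blinfun_apply_scaleC cinner_scaleC_right cinner_scaleC_left)
  then have "v = 0" by (simp add: cinner_self)
  then show "\<Phi> (c *\<^sub>C x) h = (c *\<^sub>C \<Phi> x) h" by (simp add: v_def blinfun_apply_scaleC)
qed

lemma Phi_diff: "\<Phi> (x - y) = \<Phi> x - \<Phi> y"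
  using Phi_add[of "x - y" y] by simp

lemma act_diff_left: "act (x - y) a = act x a - act y a"
  using module_simps(1)[of "x - y" y a] by simp

abbreviation "M \<equiv> multiplicative_domain \<phi>"
abbreviation "D \<equiv> module_domain act \<phi> \<Phi>"

lemma module_domain_csubspace: "csubspace D"
proof -
  have "\<Phi> 0 = 0" "act 0 b = 0" for b
    using Phi_diff[of 0 0] act_diff_left[of 0 0 b] by simp_all
  then show ?thesis
    by (simp add: csubspace_def module_domain_def module_simps Phi_add Phi_scaleC)
      (auto intro!: blinfun_eqI simp: blinfun.add_left blinfun_apply_scaleC)
qed

lemma act_in_module_domain: "x \<in> D \<Longrightarrow> a \<in> M \<Longrightarrow> act x a \<in> D"
  by (simp add: module_domain_def multiplicative_domain_def blinfun_compose_assoc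
      flip: module_simps(3))

text \<open>Right factors are absorbed by the second argument, \<open>\<langle>x, y\<rangle>b = \<langle>x, yb\<rangle>\<close>, and left factors by the first,
  \<open>b\<langle>x, y\<rangle> = \<langle>xb\<^sup>*, y\<rangle>\<close>; the latter uses that \<open>\<phi>\<close> preserves adjoints.\<close>
lemma ip_in_multiplicative_domain:
  assumes x: "x \<in> D" and y: "y \<in> D"
  shows "ip x y \<in> M"
proof -
  have "\<phi> (ip x y * b) = \<phi> (ip x y) o\<^sub>L \<phi> b" for b
  proof -
    have "\<phi> (ip x y * b) = adj (\<Phi> x) o\<^sub>L \<Phi> (act y b)" by (simp add: Phi_adj module_simps)
    also have "\<dots> = adj (\<Phi> x) o\<^sub>L \<Phi> y o\<^sub>L \<phi> b"
      using y by (simp add: module_domain_def blinfun_compose_assoc)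
    finally show ?thesis by (simp add: Phi_adj)
  qed
  moreover have "\<phi> (b * ip x y) = \<phi> b o\<^sub>L \<phi> (ip x y)" for b
  proof -
    have "\<phi> (b * ip x y) = adj (\<Phi> (act x (star b))) o\<^sub>L \<Phi> y"
      by (simp add: Phi_adj ip_act_left star_star)
    also have "\<Phi> (act x (star b)) = \<Phi> x o\<^sub>L \<phi> (star b)" using x by (simp add: module_domain_def)
    also have "adj \<dots> = \<phi> b o\<^sub>L adj (\<Phi> x)"
      by (simp add: adj_compose Phi_cblin phi.cblin cblin_adj phi.adj_star adj_adj)
    finally show ?thesis by (simp add: Phi_adj blinfun_compose_assoc)
  qed
  ultimately show ?thesis by (simp add: multiplicative_domain_def)
qed

text \<open>Here \<open>\<parallel>\<Phi>(x)\<parallel>\<^sup>2 = \<parallel>\<phi>(\<langle>x, x\<rangle>)\<parallel>\<close>, and \<open>\<phi>\<close> is bounded.\<close>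
lemma Phi_bounded: "\<exists>K\<ge>0. \<forall>x. norm (\<Phi> x) \<le> K * sqrt (norm (ip x x))"
proof -
  obtain K where K: "0 \<le> K" "\<And>a. norm (\<phi> a) \<le> norm a * K"
    using bounded_linear.nonneg_bounded[OF phi.bounded_linear] by blast
  have "norm (\<Phi> x) \<le> sqrt K * sqrt (norm (ip x x))" for x
  proof (rule power2_le_imp_le)
    show "(norm (\<Phi> x))\<^sup>2 \<le> (sqrt K * sqrt (norm (ip x x)))\<^sup>2"
      using norm_square_le_of_adj_compose[OF Phi_cblin[of x]] K
      by (simp add: Phi_adj power_mult_distrib mult.commute) (metis order_trans)
  qed (use K in simp)
  then show ?thesis using K(1) by (intro exI[of _ "sqrt K"]) auto
qed

lemma norm_ip_act_le: "sqrt (norm (ip (act x b) (act x b))) \<le> norm b * sqrt (norm (ip x x))"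
proof (rule real_le_lsqrt)
  have "norm (star b * ip x x) * norm b \<le> norm b * norm (ip x x) * norm b"
    using norm_mult_ineq[of "star b" "ip x x"] by (intro mult_right_mono) auto
  then have "norm (star b * ip x x * b) \<le> norm b * norm (ip x x) * norm b"
    by (rule order_trans[OF norm_mult_ineq])
  then show "norm (ip (act x b) (act x b)) \<le> (norm b * sqrt (norm (ip x x)))\<^sup>2"
    by (simp add: ip_act_left module_simps power_mult_distrib mult.assoc power2_eq_square mult_ac)
qed auto

text \<open>The module domain is closed because \<open>\<Phi>\<close> and the action of \<open>b\<close> are continuous for the module norm; with
  the completeness of the full module this gives its completeness.\<close>
lemma module_domain_limit:
  assumes s: "\<And>n. s n \<in> D" and lim: "(\<lambda>n. sqrt (norm (ip (s n - x) (s n - x)))) \<longlonglongrightarrow> 0"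
  shows "x \<in> D"
proof -
  obtain K where K: "0 \<le> K" "\<And>x. norm (\<Phi> x) \<le> K * sqrt (norm (ip x x))"
    using Phi_bounded by blast
  have "\<Phi> (act x b) = \<Phi> x o\<^sub>L \<phi> b" for b
  proof -
    define C where "C = K * norm b + K * norm (\<phi> b)"
    define R where "R = \<Phi> (act x b) - (\<Phi> x o\<^sub>L \<phi> b)"
    have "norm R \<le> C * sqrt (norm (ip (s n - x) (s n - x)))" for n
    proof -
      define u where "u = s n - x"
      have "\<Phi> (act (s n) b) = \<Phi> (s n) o\<^sub>L \<phi> b" using s[of n] by (simp add: module_domain_def)
      then have "R = (\<Phi> u o\<^sub>L \<phi> b) - \<Phi> (act u b)"
        by (simp add: R_def u_def act_diff_left Phi_diff
            bounded_bilinear.diff_left[OF bounded_bilinear_blinfun_compose])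
      then have "norm R \<le> norm (\<Phi> u o\<^sub>L \<phi> b) + norm (\<Phi> (act u b))"
        by (simp add: norm_triangle_ineq4)
      also have "norm (\<Phi> u o\<^sub>L \<phi> b) \<le> K * sqrt (norm (ip u u)) * norm (\<phi> b)"
        by (rule order_trans[OF norm_blinfun_compose mult_right_mono[OF K(2)]]) simp
      also have "norm (\<Phi> (act u b)) \<le> K * (norm b * sqrt (norm (ip u u)))"
        by (rule order_trans[OF K(2) mult_left_mono[OF norm_ip_act_le K(1)]])
      finally show ?thesis by (simp add: C_def u_def algebra_simps)
    qed
    moreover have "(\<lambda>n. C * sqrt (norm (ip (s n - x) (s n - x)))) \<longlonglongrightarrow> 0"
      using tendsto_mult_right_zero[OF lim] .
    ultimately have "norm R \<le> 0" by (intro LIMSEQ_le_const) auto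
    then show ?thesis by (simp add: R_def)
  qed
  then show ?thesis by (simp add: module_domain_def)
qed

lemma module_domain_hilbert_module: "hilbert_cstar_module M D act ip"
proof unfold_locales
  show "cstar_subalgebra M" by (rule phi.multiplicative_domain_cstar_subalgebra)
  show "csubspace D" by (rule module_domain_csubspace)
  show "act x a \<in> D" if "x \<in> D" "a \<in> M" for x a using that by (rule act_in_module_domain)
  show "ip x y \<in> M" if "x \<in> D" "y \<in> D" for x y
    using that by (rule ip_in_multiplicative_domain)
  \<comment> \<open>The ambient module provides \<open>b\<close> in the whole algebra; the square root moves it into \<open>M\<close>.\<close>
  show "\<exists>b\<in>M. ip x x = star b * b" if "x \<in> D" for x
  proof (rule pos_elem_sqrt)
    show "cstar_subalgebra M" by (rule phi.multiplicative_domain_cstar_subalgebra)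
    show "ip x x \<in> M" using that that by (rule ip_in_multiplicative_domain)
    show "pos_elem (ip x x)" using ip_pos[of x] by (auto simp: pos_elem_def)
  qed
  show "x = 0" if "ip x x = 0" for x using ip_definite[OF UNIV_I that] .
  show "\<exists>x\<in>D. (\<lambda>n. sqrt (norm (ip (s n - x) (s n - x)))) \<longlonglongrightarrow> 0"
    if s: "\<And>n. s n \<in> D"
      and cauchy: "\<forall>e>0. \<exists>N. \<forall>m\<ge>N. \<forall>n\<ge>N. sqrt (norm (ip (s m - s n) (s m - s n))) < e" for s
  proof -
    obtain x where x: "(\<lambda>n. sqrt (norm (ip (s n - x) (s n - x)))) \<longlonglongrightarrow> 0"
      using complete[OF UNIV_I cauchy] by blast
    then show ?thesis using module_domain_limit[of s, OF s] by blast
  qed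
qed (simp_all add: module_simps)

lemma module_domain_representation: "phi_representation M D ip \<phi> \<Phi>"
  unfolding phi_representation_def star_homomorphism_on_def phi_map_def clinear_on_def
  by (auto simp: phi.cblin phi.add phi.scaleC phi.adj_star Phi_cblin Phi_adj
      multiplicative_domain_def)

lemma module_domain_ternary: "ternary_map D act ip \<Phi>"
  unfolding ternary_map_def
  by (auto simp: Phi_cblin module_domain_def blinfun_compose_assoc simp flip: Phi_adj)

end

theorem theorem3p3:
  fixes act :: "'x::complex_vector \<Rightarrow> 'a::cstar_algebra \<Rightarrow> 'x"
    and ip :: "'x \<Rightarrow> 'x \<Rightarrow> 'a"
    and \<phi> :: "'a \<Rightarrow> ('h::chilbert_space \<Rightarrow>\<^sub>L 'h)"
    and \<Phi> :: "'x \<Rightarrow> ('h \<Rightarrow>\<^sub>L 'k::chilbert_space)"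
  assumes "hilbert_cstar_module UNIV UNIV act ip"
    and "range \<phi> \<subseteq> cblin" and "clinear_on UNIV \<phi>" and "completely_positive \<phi>"
    and "phi_map UNIV ip \<phi> \<Phi>"
  shows "hilbert_cstar_module (multiplicative_domain \<phi>) (module_domain act \<phi> \<Phi>) act ip \<and>
    phi_representation (multiplicative_domain \<phi>) (module_domain act \<phi> \<Phi>) ip \<phi> \<Phi> \<and>
    ternary_map (module_domain act \<phi> \<Phi>) act ip \<Phi>"
proof -
  have pos: "\<exists>T\<in>cblin. \<phi> (star b * b) = adj T o\<^sub>L (T :: 'h \<Rightarrow>\<^sub>L 'h)" for b
  proof -
    have "positive_matrix UNIV (*) star 1 (\<lambda>_ _. star b * b)"
      unfolding positive_matrix_def by (rule exI[of _ "\<lambda>_ _. b"]) simp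
    then have "positive_matrix cblin (o\<^sub>L) adj 1 (\<lambda>_ _. \<phi> (star b * b))"
      using assms(4) unfolding completely_positive_def by blast
    then show ?thesis unfolding positive_matrix_def by auto
  qed
  interpret hilbert_cstar_module UNIV UNIV act ip by (rule assms(1))
  interpret phi_module_map act ip \<phi> \<Phi>
    using assms(2,3,5) pos
    by unfold_locales (auto simp: clinear_on_def phi_map_def)
  show ?thesis using module_domain_hilbert_module module_domain_representation module_domain_ternary by blast
qed

end
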